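(* Let $p$ and $q$ be monic polynomials with degree $2$ over $\mathbb{F}$, and assume that they are both irreducible and separable, with distinct splitting fields (in $\overline{\mathbb{F}}$), and that $(\operatorname{tr}p,\operatorname{tr}q)\neq(0,0)$. Let $u$ be an endomorphism of a finite-dimensional vector space $V$ over $\mathbb{F}$. Then, the following conditions are equivalent: (i) The endomorphism $u$ is a q-exceptional $(p,q)$-quotient. (ii) The minimal polynomial of $u$ is a power of $G_{p,q}$ and, if we denote by $r_1,\dots,r_k,\dots$ the invariant factors of $u$, then $r_{2k-1}=r_{2k}$ or $r_{2k-1}=r_{2k}\,G_{p,q}$, for all $k\geq 1$. (iii) In some basis of $V$, the endomorphism $u$ is represented by a block-diagonal matrix in which each diagonal block equals $C\bigl(G_{p,q}^n\bigr)\oplus C\bigl(G_{p,q}^n\bigr)$ or $C\bigl(G_{p,q}^n\bigr)\oplus C\bigl(G_{p,q}^{n-1}\bigr)$ for some positive integer $n$.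
   Context: $\mathbb{F}$ is an arbitrary field with algebraic closure $\overline{\mathbb{F}}$. For a monic polynomial $p$ of degree $n\ge 1$, $\operatorname{tr}(p)$ is the opposite of the coefficient of $p$ on $t^{n-1}$, and $\operatorname{Root}(p)$ is its set of roots in $\overline{\mathbb{F}}$. If $p(t)=(t-x_1)(t-x_2)$ and $q(t)=(t-y_1)(t-y_2)$ in $\overline{\mathbb{F}}[t]$, with $p(0)q(0)\neq0$, then $G_{p,q}(t):=\prod_{1\leq i,j\leq 2}\bigl(t-x_iy_j^{-1}\bigr)$, a monic polynomial of degree $4$ in $\mathbb{F}[t]$. An endomorphism $u$ of $V$ is a $(p,q)$-quotient if $u=ab^{-1}$ for some automorphisms $a,b$ of $V$ with $p(a)=0$ and $q(b)=0$. It is q-exceptional with respect to $(p,q)$ if all its eigenvalues in $\overline{\mathbb{F}}$ belong to $\operatorname{Root}(p)\operatorname{Root}(q)^{-1}=\{xy^{-1}: x\in\operatorname{Root}(p),\,y\in\operatorname{Root}(q)\}$; a q-exceptional $(p,q)$-quotient is a $(p,q)$-quotient that is q-exceptional with respect to $(p,q)$. $C(r)$ is the companion matrix of the monic polynomial $r$ ($C(1)$ is the $0\times0$ matrix), and $\oplus$ is block-diagonal sum. The invariant factors of $u$ are the monic polynomials $r_1,r_2,\dots$ with $r_{i+1}\mid r_i$ such that $u$ is represented in some basis by $C(r_1)\oplus C(r_2)\oplus\cdots$; the finite list of nonconstant ones is extended to an infinite sequence by $r_i=1$. *)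

theory Defs
  imports
    "HOL-Algebra.Algebraic_Closure_Type"
    "HOL-Algebra.Generated_Fields"
    "Jordan_Normal_Form.Char_Poly"
begin

section \<open>Polynomials and their roots in the algebraic closure\<close>

definition poly_tr :: "'a::field poly \<Rightarrow> 'a" where
  "poly_tr p = - coeff p (degree p - 1)"

definition Root :: "'a::field poly \<Rightarrow> 'a alg_closure set" where
  "Root p = {x. poly (map_poly to_ac p) x = 0}"

text \<open>Separable means: only simple roots in the algebraic closure.\<close>
definition separable_poly :: "'a::field poly \<Rightarrow> bool" where
  "separable_poly p \<longleftrightarrow> rsquarefree (map_poly to_ac p)"

text \<open>The subfield of the algebraic closure generated by the base field and the roots.\<close>
definition splitting_field :: "'a::field poly \<Rightarrow> 'a alg_closure set" where
  "splitting_field p = generate_field ring_of_type_algebra (range to_ac \<union> Root p)"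

text \<open>
  The product over all pairs of roots, counted with multiplicity, computed over the algebraic
  closure and then pulled back along \<^const>\<open>to_ac\<close>. The pull-back \<^const>\<open>of_ac\<close> sends
  elements outside the base field to \<open>0\<close>; the lemma \<open>map_poly_to_ac_quot_poly\<close> below shows
  that no coefficient is lost that way.
\<close>
definition quot_poly_ac :: "'a::field poly \<Rightarrow> 'a poly \<Rightarrow> 'a alg_closure poly" where
  "quot_poly_ac p q =
     (\<Prod>x\<in>#proots (map_poly to_ac p). \<Prod>y\<in>#proots (map_poly to_ac q). [:- (x * inverse y), 1:])"

definition quot_poly :: "'a::field poly \<Rightarrow> 'a poly \<Rightarrow> 'a poly" where
  "quot_poly p q = map_poly of_ac (quot_poly_ac p q)"


section \<open>Endomorphisms and their matrices\<close>

text \<open>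
  Vector spaces over the field \<^typ>\<open>'a\<close> are given, as in \<^theory>\<open>HOL.Vector_Spaces\<close>, by a scalar
  multiplication \<open>s\<close> on a type \<^typ>\<open>'v\<close>.
\<close>

definition automorphism :: "('a::field \<Rightarrow> 'v::ab_group_add \<Rightarrow> 'v) \<Rightarrow> ('v \<Rightarrow> 'v) \<Rightarrow> bool" where
  "automorphism s a \<longleftrightarrow> Vector_Spaces.linear s s a \<and> bij a"

definition poly_end ::
    "('a::field \<Rightarrow> 'v::ab_group_add \<Rightarrow> 'v) \<Rightarrow> 'a poly \<Rightarrow> ('v \<Rightarrow> 'v) \<Rightarrow> 'v \<Rightarrow> 'v" where
  "poly_end s f u v = (\<Sum>i\<le>degree f. s (coeff f i) ((u ^^ i) v))"

definition is_minimal_polynomial ::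
    "('a::field \<Rightarrow> 'v::ab_group_add \<Rightarrow> 'v) \<Rightarrow> ('v \<Rightarrow> 'v) \<Rightarrow> 'a poly \<Rightarrow> bool" where
  "is_minimal_polynomial s u m \<longleftrightarrow>
     lead_coeff m = 1 \<and> (\<forall>v. poly_end s m u v = 0) \<and>
     (\<forall>f. (\<forall>v. poly_end s f u v = 0) \<longrightarrow> m dvd f)"

definition is_basis :: "('a::field \<Rightarrow> 'v::ab_group_add \<Rightarrow> 'v) \<Rightarrow> 'v list \<Rightarrow> bool" where
  "is_basis s bs \<longleftrightarrow> distinct bs \<and> \<not> Modules.module.dependent s (set bs) \<and>
     Modules.module.span s (set bs) = UNIV"

definition represents ::
    "('a::field \<Rightarrow> 'v::ab_group_add \<Rightarrow> 'v) \<Rightarrow> ('v \<Rightarrow> 'v) \<Rightarrow> 'v list \<Rightarrow> 'a mat \<Rightarrow> bool" where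
  "represents s u bs M \<longleftrightarrow> is_basis s bs \<and> M \<in> carrier_mat (length bs) (length bs) \<and>
     (\<forall>j<length bs. u (bs ! j) = (\<Sum>i<length bs. s (M $$ (i, j)) (bs ! i)))"

text \<open>
  Eigenvalues of \<open>u\<close> in the algebraic closure: those of a matrix of \<open>u\<close> after extension of
  scalars. They do not depend on the chosen basis.
\<close>
definition ac_eigenvalue ::
    "('a::field \<Rightarrow> 'v::ab_group_add \<Rightarrow> 'v) \<Rightarrow> ('v \<Rightarrow> 'v) \<Rightarrow> 'a alg_closure \<Rightarrow> bool" where
  "ac_eigenvalue s u c \<longleftrightarrow> (\<exists>bs M. represents s u bs M \<and> eigenvalue (map_mat to_ac M) c)"

text \<open>Ones below the diagonal, last column \<open>-r\<^sub>0, \<dots>, -r\<^sub>n\<^sub>-\<^sub>1\<close>; \<open>0 \<times> 0\<close> for \<open>r = 1\<close>.\<close>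
definition companion :: "'a::field poly \<Rightarrow> 'a mat" where
  "companion r = mat (degree r) (degree r)
     (\<lambda>(i, j). if Suc j = degree r then - coeff r i else if i = Suc j then 1 else 0)"

text \<open>
  The sequence is indexed from \<open>0\<close>, so \<open>r i\<close> is the \<open>(i+1)\<close>-st invariant factor. Since the
  companion matrix of \<open>1\<close> is empty, the choice of the cut-off \<open>N\<close> is immaterial.
\<close>
definition is_invariant_factors ::
    "('a::field \<Rightarrow> 'v::ab_group_add \<Rightarrow> 'v) \<Rightarrow> ('v \<Rightarrow> 'v) \<Rightarrow> (nat \<Rightarrow> 'a poly) \<Rightarrow> bool" where
  "is_invariant_factors s u r \<longleftrightarrow>
     (\<forall>i. lead_coeff (r i) = 1 \<and> r (Suc i) dvd r i) \<and>
     (\<exists>N. (\<forall>i\<ge>N. r i = 1) \<and>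
          (\<exists>bs. represents s u bs (diag_block_mat (map (\<lambda>i. companion (r i)) [0..<N]))))"


section \<open>Quotients\<close>

definition is_quotient ::
    "('a::field \<Rightarrow> 'v::ab_group_add \<Rightarrow> 'v) \<Rightarrow> 'a poly \<Rightarrow> 'a poly \<Rightarrow> ('v \<Rightarrow> 'v) \<Rightarrow> bool" where
  "is_quotient s p q u \<longleftrightarrow> (\<exists>a b. automorphism s a \<and> automorphism s b \<and>
     (\<forall>v. poly_end s p a v = 0) \<and> (\<forall>v. poly_end s q b v = 0) \<and> u = a \<circ> inv_into UNIV b)"

definition q_exceptional ::
    "('a::field \<Rightarrow> 'v::ab_group_add \<Rightarrow> 'v) \<Rightarrow> 'a poly \<Rightarrow> 'a poly \<Rightarrow> ('v \<Rightarrow> 'v) \<Rightarrow> bool" where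
  "q_exceptional s p q u \<longleftrightarrow>
     (\<forall>c. ac_eigenvalue s u c \<longrightarrow> c \<in> {x * inverse y | x y. x \<in> Root p \<and> y \<in> Root q})"


section \<open>The quotient polynomial lies over the base field\<close>

lemma proots_quadratic_ac:
  fixes p :: "'a::field poly"
  assumes "lead_coeff p = 1" "degree p = 2"
  obtains x y where "proots (map_poly to_ac p) = {#x, y#}"
    "to_ac (coeff p 1) = - (x + y)" "to_ac (coeff p 0) = x * y"
    "map_poly to_ac p = [:- x, 1:] * [:- y, 1:]"
proof -
  let ?P = "map_poly to_ac p"
  have d: "degree ?P = 2" using assms by (subst degree_map_poly) auto
  have l: "lead_coeff ?P = 1" using assms d by (simp add: coeff_map_poly)
  have nz: "?P \<noteq> 0" using d by auto
  obtain x where "poly ?P x = 0" using alg_closed_imp_poly_has_root[of ?P] d by auto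
  then obtain Q where Q: "?P = [:- x, 1:] * Q" by (metis dvdE poly_eq_0_iff_dvd)
  have Qnz: "Q \<noteq> 0" using Q nz by auto
  have dQ: "degree Q = 1" using d Q Qnz by (simp add: degree_mult_eq del: mult_pCons_left)
  obtain y where "poly Q y = 0" using alg_closed_imp_poly_has_root[of Q] dQ by auto
  then obtain R where R: "Q = [:- y, 1:] * R" by (metis dvdE poly_eq_0_iff_dvd)
  have Rnz: "R \<noteq> 0" using R Qnz by auto
  have dR: "degree R = 0" using dQ R Rnz by (simp add: degree_mult_eq del: mult_pCons_left)
  have "lead_coeff R = 1" using l unfolding Q R
    by (simp only: lead_coeff_mult) simp
  hence "R = 1" using dR by (auto elim!: degree_eq_zeroE)
  hence P: "?P = [:- x, 1:] * [:- y, 1:]" using Q R by simp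
  have "proots ?P = {#x, y#}" unfolding P
    by (subst proots_mult) auto
  moreover have "to_ac (coeff p 1) = coeff ?P 1" "to_ac (coeff p 0) = coeff ?P 0"
    by (simp_all add: coeff_map_poly)
  hence "to_ac (coeff p 1) = - (x + y)" "to_ac (coeff p 0) = x * y"
    unfolding P by simp_all
  ultimately show ?thesis using that P by blast
qed

lemma quot_poly_ac_explicit:
  fixes p q :: "'a::field poly"
  assumes p: "lead_coeff p = 1" "degree p = 2" and q: "lead_coeff q = 1" "degree q = 2"
    and nz: "coeff q 0 \<noteq> 0"
  defines "a \<equiv> - coeff p 1" and "b \<equiv> coeff p 0"
    and "c \<equiv> - coeff q 1 / coeff q 0" and "d \<equiv> 1 / coeff q 0"
  shows "quot_poly_ac p q = map_poly to_ac
    [:b^2 * d^2, - (a * b * c * d), a^2 * d + b * c^2 - 2 * b * d, - (a * c), 1:]"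
proof -
  obtain x1 x2 where x: "proots (map_poly to_ac p) = {#x1, x2#}"
    "to_ac (coeff p 1) = - (x1 + x2)" "to_ac (coeff p 0) = x1 * x2"
    using proots_quadratic_ac[OF p] by metis
  obtain y1 y2 where y: "proots (map_poly to_ac q) = {#y1, y2#}"
    "to_ac (coeff q 1) = - (y1 + y2)" "to_ac (coeff q 0) = y1 * y2"
    using proots_quadratic_ac[OF q] by metis
  have "to_ac (coeff q 0) \<noteq> 0" using nz by simp
  hence ynz: "y1 \<noteq> 0" "y2 \<noteq> 0" using y(3) by auto
  define z1 z2 where "z1 = inverse y1" and "z2 = inverse y2"
  have a: "to_ac a = x1 + x2" and b: "to_ac b = x1 * x2"
    using x by (simp_all add: a_def b_def)
  have c: "to_ac c = z1 + z2" and d: "to_ac d = z1 * z2"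
    using ynz y(2)[unfolded One_nat_def] y(3)
    by (simp_all add: c_def d_def z1_def z2_def divide_simps del: add_uminus_conv_diff)
  have "quot_poly_ac p q =
      [:- (x1 * z1), 1:] * [:- (x1 * z2), 1:] * ([:- (x2 * z1), 1:] * [:- (x2 * z2), 1:])"
    by (simp add: quot_poly_ac_def x y z1_def z2_def del: mult_pCons_left mult_pCons_right)
  also have "\<dots> = map_poly to_ac
    [:b^2 * d^2, - (a * b * c * d), a^2 * d + b * c^2 - 2 * b * d, - (a * c), 1:]"
    by (simp add: map_poly_pCons a b c d power2_eq_square algebra_simps)
  finally show ?thesis .
qed

lemma map_poly_to_ac_quot_poly:
  fixes p q :: "'a::field poly"
  assumes "lead_coeff p = 1" "degree p = 2" "lead_coeff q = 1" "degree q = 2" "coeff q 0 \<noteq> 0"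
  shows "map_poly to_ac (quot_poly p q) = quot_poly_ac p q"
proof -
  obtain g :: "'a poly" where g: "quot_poly_ac p q = map_poly to_ac g"
    using quot_poly_ac_explicit[OF assms] by blast
  have "of_ac (0 :: 'a alg_closure) = 0" by (rule of_ac_eqI) simp
  hence "quot_poly p q = g"
    unfolding quot_poly_def g by (intro poly_eqI) (simp add: coeff_map_poly)
  thus ?thesis by (simp add: g)
qed

end

theory Submission
  imports Defs
begin

text \<open>
  Write \<open>\<delta> = p(0) / q(0)\<close> and \<open>\<alpha> = p(0)\<close>. If \<open>u = a b\<^sup>-\<^sup>1\<close> with \<open>p(a) = 0 = q(b)\<close>, the commutator
  \<open>C = u a - a u\<close> satisfies \<open>C u = \<delta> u\<^sup>-\<^sup>1 C\<close> and \<open>u\<^sup>2 C\<^sup>2 = \<alpha> G(u)\<close>. Conversely, if \<open>u\<close> is annihilated by a power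
  of \<open>G\<close>, then \<open>u - \<delta> u\<^sup>-\<^sup>1\<close> is invertible and \<open>a\<close>, hence \<open>b = u\<^sup>-\<^sup>1 a\<close>, can be recovered from such a \<open>C\<close>.
  The hypotheses on \<open>p\<close> and \<open>q\<close> make \<open>G\<close> irreducible. So \<open>u\<close> and \<open>C\<close> make \<open>V\<close> a module over a
  noncommutative chain ring whose maximal ideal is generated by \<open>C\<close>, and \<open>G(u)\<close> is \<open>C\<^sup>2\<close> up to a unit.
  Such a module is a direct sum of cyclic ones; one of length \<open>m\<close>, generated by \<open>v\<close>, is as a module over
  \<open>F[u]\<close> the direct sum of the cyclic modules generated by \<open>v\<close> and \<open>C v\<close>, of orders
  \<open>G\<close> to the powers \<open>\<lceil>m/2\<rceil>\<close> and \<open>\<lfloor>m/2\<rfloor>\<close>. Conversely, a \<open>C\<close> can be written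
  down on each pair of blocks of condition (iii).
\<close>

section \<open>Irreducibility of the quotient polynomial\<close>

text \<open>The commutator removes an inhomogeneity. Eliminating \<open>b\<close> from
  \<open>u b = a\<close> and \<open>q(b) = 0\<close> gives \<open>a u = \<delta> u\<^sup>-\<^sup>1 a
  + \<tau> u - \<delta> \<mu>\<close>, where \<tau> and \<mu> are the traces; the last two terms
  commute with \<open>u\<close>, so \<open>C\<close> keeps only the twist. The same identity reads
  \<open>(u - \<delta> u\<^sup>-\<^sup>1) a = C + \<tau> u - \<delta> \<mu>\<close>, which is how
  \<open>a\<close> is recovered. The twist respects \<open>G\<close>: if \<open>x'\<close> and
  \<open>y'\<close> are the second roots, then \<delta> is the product of \<open>x/y\<close> and
  \<open>x'/y'\<close>, so \<open>t \<mapsto> \<delta>/t\<close> permutes the roots of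
  \<open>G\<close>. Splitting off a cyclic module needs a complement over a noncommutative ring. It
  is found by duality: for a vector \<open>v\<close> of maximal length \<open>m\<close>, take a
  linear functional that does not vanish at \<open>C^(m-1) v\<close>, and the largest submodule
  inside its kernel. This submodule meets the one generated by \<open>v\<close> trivially, since
  every nonzero submodule of the latter contains \<open>C^(m-1) v\<close>; its codimension is
  bounded by counting linear conditions.\<close>

lemma (in Fields.field) ring_of_type_algebra_simps:
  "x \<oplus>\<^bsub>ring_of_type_algebra\<^esub> y = x + y" "x \<otimes>\<^bsub>ring_of_type_algebra\<^esub> y = x * y"
  by (simp_all add: ring_of_type_algebra_def)

lemma splitting_field_add:
  "x \<in> splitting_field p \<Longrightarrow> y \<in> splitting_field p \<Longrightarrow> x + y \<in> splitting_field p"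
  using generate_field.eng_add[of x ring_of_type_algebra _ y]
  by (simp add: splitting_field_def ring_of_type_algebra_simps)

lemma splitting_field_mult:
  "x \<in> splitting_field p \<Longrightarrow> y \<in> splitting_field p \<Longrightarrow> x * y \<in> splitting_field p"
  using generate_field.eng_mult[of x ring_of_type_algebra _ y]
  by (simp add: splitting_field_def ring_of_type_algebra_simps)

lemma to_ac_in_splitting_field: "to_ac c \<in> splitting_field p"
  unfolding splitting_field_def by (rule generate_field.incl) auto

lemma Root_subset_splitting_field: "Root p \<subseteq> splitting_field p"
  unfolding splitting_field_def by (auto intro: generate_field.incl)

lemma splitting_field_subset:
  fixes p q :: "'a::field poly"
  assumes "Root q \<subseteq> splitting_field p"
  shows "splitting_field q \<subseteq> splitting_field p"
proof -
  interpret K: field "ring_of_type_algebra :: 'a alg_closure ring"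
    by (rule field_from_type_algebra)
  have c: "carrier (ring_of_type_algebra :: 'a alg_closure ring) = UNIV"
    by (simp add: ring_of_type_algebra_def)
  show ?thesis
    unfolding splitting_field_def
  proof (rule K.generate_field_min_subfield1)
    show "subfield (generate_field ring_of_type_algebra (range to_ac \<union> Root p)) ring_of_type_algebra"
      by (rule K.generate_field_is_subfield) (simp add: c)
    show "range to_ac \<union> Root q \<subseteq> generate_field ring_of_type_algebra (range to_ac \<union> Root p)"
      using assms to_ac_in_splitting_field[of _ p] unfolding splitting_field_def by auto
  qed (simp add: c)
qed

section \<open>Roots of quadratics and linear relations between them\<close>

lemma Root_quadratic:
  fixes p :: "'a::field poly"
  assumes "lead_coeff p = 1" "degree p = 2" "x \<in> Root p"
  defines "x' \<equiv> - to_ac (coeff p 1) - x"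
  shows "map_poly to_ac p = [:- x, 1:] * [:- x', 1:]" "Root p = {x, x'}"
    "x * x' = to_ac (coeff p 0)"
proof -
  obtain a b where ab: "to_ac (coeff p 1) = - (a + b)" "to_ac (coeff p 0) = a * b"
    "map_poly to_ac p = [:- a, 1:] * [:- b, 1:]"
    using proots_quadratic_ac[OF assms(1,2)] by metis
  have R: "Root p = {a, b}" unfolding Root_def ab(3) poly_mult by auto
  have "x = a \<and> x' = b \<or> x = b \<and> x' = a"
    using assms(3) R ab(1) unfolding x'_def by auto
  then show "map_poly to_ac p = [:- x, 1:] * [:- x', 1:]" "Root p = {x, x'}"
    "x * x' = to_ac (coeff p 0)"
    using ab R by (auto simp: algebra_simps)
qed

lemma irreducible_quadratic_no_root:
  fixes p :: "'a::field poly"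
  assumes "Factorial_Ring.irreducible p" "degree p = 2"
  shows "poly p c \<noteq> 0"
proof
  assume "poly p c = 0"
  then obtain r where r: "p = [:- c, 1:] * r" by (metis dvdE poly_eq_0_iff_dvd)
  then have "[:- c, 1:] dvd 1 \<or> r dvd 1"
    using assms(1) by (metis Factorial_Ring.irreducibleD)
  moreover have "r \<noteq> 0" using r assms(2) by auto
  then have "degree r = 1" using r assms(2) by (simp add: degree_mult_eq del: mult_pCons_left)
  ultimately show False by (auto simp: is_unit_iff_degree)
qed

lemma Root_not_in_range:
  fixes p :: "'a::field poly"
  assumes "Factorial_Ring.irreducible p" "degree p = 2" "x \<in> Root p"
  shows "x \<noteq> to_ac c"
proof
  assume "x = to_ac c"
  then have "to_ac (poly p c) = 0"
    using assms(3) by (simp add: Root_def poly_altdef degree_map_poly coeff_map_poly to_ac_sum)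
  then show False using irreducible_quadratic_no_root[OF assms(1,2)] by simp
qed

text \<open>An affine relation with \<open>d \<noteq> 0\<close> can be solved for either root, and
  the trace puts the second root of each quadratic into the field generated by the first.\<close>

lemma splitting_field_eqI:
  fixes p q :: "'a::field poly"
  assumes p: "lead_coeff p = 1" "degree p = 2" and q: "lead_coeff q = 1" "degree q = 2"
    and xy: "x \<in> Root p" "y \<in> Root q" "y = to_ac c + to_ac d * x" and d: "d \<noteq> 0"
  shows "splitting_field p = splitting_field q"
proof -
  have sub: "splitting_field q \<subseteq> splitting_field p"
    if p: "lead_coeff p = 1" "degree p = 2" and q: "lead_coeff q = 1" "degree q = 2"
    and xy: "x \<in> Root p" "y \<in> Root q" "y = to_ac c + to_ac d * x"
    for p q :: "'a poly" and x y c d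
  proof (rule splitting_field_subset)
    have x: "x \<in> splitting_field p" using Root_subset_splitting_field xy(1) by auto
    then have y: "y \<in> splitting_field p"
      unfolding xy(3) by (intro splitting_field_add splitting_field_mult to_ac_in_splitting_field)
    have "to_ac (- coeff q 1) + to_ac (- 1) * y \<in> splitting_field p"
      by (intro splitting_field_add splitting_field_mult to_ac_in_splitting_field y)
    then show "Root q \<subseteq> splitting_field p"
      using y unfolding Root_quadratic(2)[OF q xy(2)] by auto
  qed
  have "x = to_ac (- c / d) + to_ac (1 / d) * y"
    unfolding xy(3) using d by (simp add: distrib_left)
  then show ?thesis
    using sub[OF p q xy] sub[OF q p xy(2,1)] by blast
qed

lemma irreducible_quadratic_linear_eq_0:
  fixes p :: "'a::field poly"
  assumes "Factorial_Ring.irreducible p" "degree p = 2" "x \<in> Root p"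
    and "to_ac c + to_ac d * x = 0"
  shows "c = 0 \<and> d = 0"
proof -
  have "d = 0"
  proof (rule ccontr)
    assume "d \<noteq> 0"
    then have "x = to_ac (- c / d)" using assms(4) by (simp add: field_simps add_eq_0_iff)
    then show False using Root_not_in_range[OF assms(1-3)] by blast
  qed
  then show ?thesis using assms(4) by simp
qed

text \<open>If \<open>c2 + c3 x\<close> were nonzero, the relation could be solved for
  \<open>y\<close>, which would become an affine function of \<open>x\<close> over the base field
  and make the splitting fields equal.\<close>

lemma biquadratic_independent:
  fixes p q :: "'a::field poly"
  assumes p: "lead_coeff p = 1" "degree p = 2" and q: "lead_coeff q = 1" "degree q = 2"
    and irr: "Factorial_Ring.irreducible p" "Factorial_Ring.irreducible q"
    and dist: "splitting_field p \<noteq> splitting_field q"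
    and x: "x \<in> Root p" and y: "y \<in> Root q"
    and eq: "to_ac c0 + to_ac c1 * x + to_ac c2 * y + to_ac c3 * (x * y) = 0"
  shows "c0 = 0 \<and> c1 = 0 \<and> c2 = 0 \<and> c3 = 0"
proof -
  define x' where "x' = - to_ac (coeff p 1) - x"
  have x': "x' \<in> Root p" "x * x' = to_ac (coeff p 0)"
    using Root_quadratic(2,3)[OF p x] by (auto simp: x'_def)
  have c23: "c2 = 0 \<and> c3 = 0"
  proof (rule ccontr)
    assume nz: "\<not> (c2 = 0 \<and> c3 = 0)"
    \<comment> \<open>The norm of \<open>c2 + c3 x\<close>: multiplication by the conjugate
      \<open>c2 + c3 x'\<close> clears the denominator in the formula for \<open>y\<close>.\<close>
    define n where "n = c2 * c2 - c2 * c3 * coeff p 1 + c3 * c3 * coeff p 0"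
    have "to_ac c2 + to_ac c3 * x \<noteq> 0" "to_ac c2 + to_ac c3 * x' \<noteq> 0"
      using irreducible_quadratic_linear_eq_0[OF irr(1) p(2)] nz x x'(1) by blast+
    moreover have n: "(to_ac c2 + to_ac c3 * x) * (to_ac c2 + to_ac c3 * x') = to_ac n"
      by (simp add: n_def x'(2)[symmetric]) (simp add: x'_def algebra_simps)
    ultimately have "n \<noteq> 0" by auto
    have "to_ac n * y = - (to_ac c0 + to_ac c1 * x) * (to_ac c2 + to_ac c3 * x')"
    proof -
      have "(to_ac c2 + to_ac c3 * x) * y = - (to_ac c0 + to_ac c1 * x)"
        using eq by (simp add: algebra_simps add_eq_0_iff)
      then show ?thesis unfolding n[symmetric] by (metis mult.commute mult.left_commute)
    qed
    also have "\<dots> = to_ac (c0 * c3 * coeff p 1 - c0 * c2 - c1 * c3 * coeff p 0)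
        + to_ac (c0 * c3 - c1 * c2) * x"
      by (simp add: x'(2)[symmetric]) (simp add: x'_def algebra_simps)
    finally have "y = (to_ac (c0 * c3 * coeff p 1 - c0 * c2 - c1 * c3 * coeff p 0)
        + to_ac (c0 * c3 - c1 * c2) * x) / to_ac n"
      using \<open>n \<noteq> 0\<close> by (simp add: field_simps del: to_ac_mult to_ac_diff)
    then have "y = to_ac ((c0 * c3 * coeff p 1 - c0 * c2 - c1 * c3 * coeff p 0) / n)
        + to_ac ((c0 * c3 - c1 * c2) / n) * x" (is "_ = to_ac ?c + to_ac ?d * x")
      by (simp add: add_divide_distrib)
    \<comment> \<open>A vanishing coefficient would put the root \<open>y\<close> of the irreducible
      \<open>q\<close> into the base field.\<close>
    moreover from this have "?d \<noteq> 0"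
      using Root_not_in_range[OF irr(2) q(2) y, of ?c] by (metis add.right_neutral mult_zero_left to_ac_0)
    ultimately show False
      using splitting_field_eqI[OF p q x y] dist by blast
  qed
  then show ?thesis
    using irreducible_quadratic_linear_eq_0[OF irr(1) p(2) x, of c0 c1] eq by simp
qed

text \<open>Singling out the factor of a chosen root \<open>x/y\<close> lets it be cancelled later,
  leaving the three other candidate roots.\<close>

lemma quot_poly_ac_Root:
  fixes p q :: "'a::field poly"
  assumes p: "lead_coeff p = 1" "degree p = 2" and q: "lead_coeff q = 1" "degree q = 2"
    and "x \<in> Root p" "y \<in> Root q"
  defines "x' \<equiv> - to_ac (coeff p 1) - x" and "y' \<equiv> - to_ac (coeff q 1) - y"
  shows "quot_poly_ac p q = [:- (x * inverse y), 1:] *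
    ([:- (x * inverse y'), 1:] * [:- (x' * inverse y), 1:] * [:- (x' * inverse y'), 1:])"
proof -
  have gen: "proots ([:- a, 1:] * [:- b, 1:]) = {#a, b#}" for a b :: "'a alg_closure"
    by (subst proots_mult) auto
  have P: "proots (map_poly to_ac p) = {#x, x'#}"
    unfolding Root_quadratic(1)[OF p \<open>x \<in> Root p\<close>] x'_def by (rule gen)
  have Q: "proots (map_poly to_ac q) = {#y, y'#}"
    unfolding Root_quadratic(1)[OF q \<open>y \<in> Root q\<close>] y'_def by (rule gen)
  show ?thesis unfolding quot_poly_ac_def P Q
    by (simp add: mult.assoc del: mult_pCons_left mult_pCons_right)
qed

lemma Root_nonempty:
  fixes p :: "'a::field poly"
  assumes "degree p > 0" shows "\<exists>x. x \<in> Root p"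
proof -
  have "degree (map_poly to_ac p) > 0" using assms by (subst degree_map_poly) auto
  then show ?thesis
    using alg_closed_imp_poly_has_root[of "map_poly to_ac p"] by (auto simp: Root_def)
qed

lemma Root_quot_poly:
  fixes p q :: "'a::field poly"
  assumes p: "lead_coeff p = 1" "degree p = 2" and q: "lead_coeff q = 1" "degree q = 2"
    and nz: "coeff q 0 \<noteq> 0"
  shows "Root (quot_poly p q) = {x * inverse y | x y. x \<in> Root p \<and> y \<in> Root q}"
proof -
  obtain x y where xy: "x \<in> Root p" "y \<in> Root q" using Root_nonempty[of p] Root_nonempty[of q] p q by auto
  show ?thesis
    unfolding Root_def[of "quot_poly p q"] map_poly_to_ac_quot_poly[OF p q nz]
      quot_poly_ac_Root[OF p q xy] Root_quadratic(2)[OF p xy(1)] Root_quadratic(2)[OF q xy(2)] poly_mult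
    by auto
qed

lemma quot_poly_explicit:
  fixes p q :: "'a::field poly"
  assumes p: "lead_coeff p = 1" "degree p = 2" and q: "lead_coeff q = 1" "degree q = 2"
    and nz: "coeff q 0 \<noteq> 0"
  defines "a \<equiv> - coeff p 1" and "b \<equiv> coeff p 0"
    and "c \<equiv> - coeff q 1 / coeff q 0" and "d \<equiv> 1 / coeff q 0"
  shows "quot_poly p q = [:b^2 * d^2, - (a * b * c * d), a^2 * d + b * c^2 - 2 * b * d, - (a * c), 1:]"
  using map_poly_to_ac_quot_poly[OF p q nz] quot_poly_ac_explicit[OF p q nz]
  unfolding a_def b_def c_def d_def by (auto simp: poly_eq_iff coeff_map_poly)

text \<open>A factor of degree 1 or 2 has a root \<open>x/y\<close>; if it is quadratic, its second
  root is one of the three other quotients. Sum and product of its roots lie in the base field, and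
  each case turns this into linear relations between \<open>1\<close>, \<open>x\<close>,
  \<open>y\<close>, \<open>x y\<close> that force both traces to vanish.\<close>

lemma irreducible_quot_poly:
  fixes p q :: "'a::field poly"
  assumes p: "lead_coeff p = 1" "degree p = 2" and q: "lead_coeff q = 1" "degree q = 2"
    and irr: "Factorial_Ring.irreducible p" "Factorial_Ring.irreducible q"
    and dist: "splitting_field p \<noteq> splitting_field q"
    and tr: "(poly_tr p, poly_tr q) \<noteq> (0, 0)"
  shows "Factorial_Ring.irreducible (quot_poly p q)"
proof -
  let ?G = "quot_poly p q"
  define l m al be where "l = - coeff p 1" and "m = - coeff q 1"
    and "al = coeff p 0" and "be = coeff q 0"
  have nz: "al \<noteq> 0" "be \<noteq> 0"
    using irreducible_quadratic_no_root[OF irr(1) p(2), of 0]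
      irreducible_quadratic_no_root[OF irr(2) q(2), of 0] by (auto simp: al_def be_def poly_0_coeff_0)
  have lm: "\<not> (l = 0 \<and> m = 0)" using tr p(2) q(2) by (auto simp: poly_tr_def l_def m_def)
  have G4: "degree ?G = 4" using nz by (subst quot_poly_explicit[OF p q]) (auto simp: be_def)
  note indep = biquadratic_independent[OF p q irr dist]
  \<comment> \<open>One of two factors of a quartic has degree at most 2, so only such factors have
    to be excluded.\<close>
  have no_factor: False if fg: "?G = f * g" and df: "0 < degree f" "degree f \<le> 2" for f g
  proof -
    have Gac: "map_poly to_ac ?G = quot_poly_ac p q"
      using map_poly_to_ac_quot_poly[OF p q] nz by (simp add: be_def)
    have fgac: "map_poly to_ac ?G = map_poly to_ac f * map_poly to_ac g"
      unfolding fg by (rule poly_eqI) (simp add: coeff_map_poly coeff_mult to_ac_sum)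
    obtain z where z: "z \<in> Root f" using Root_nonempty df(1) by blast
    then have "z \<in> Root ?G" by (simp add: Root_def fgac)
    then obtain x y where xy: "x \<in> Root p" "y \<in> Root q" and zxy: "z = x * inverse y"
      using Root_quot_poly[OF p q] nz by (auto simp: be_def)
    define x' y' where "x' = - to_ac (coeff p 1) - x" and "y' = - to_ac (coeff q 1) - y"
    have xx: "x' = to_ac l - x" "x * x' = to_ac al" and yy: "y' = to_ac m - y" "y * y' = to_ac be"
      using Root_quadratic(3)[OF p xy(1)] Root_quadratic(3)[OF q xy(2)]
      by (simp_all add: x'_def y'_def l_def m_def al_def be_def)
    have "x * x' \<noteq> 0" "y * y' \<noteq> 0" unfolding xx(2) yy(2) using nz by simp_all
    then have nz': "x \<noteq> 0" "x' \<noteq> 0" "y \<noteq> 0" "y' \<noteq> 0" by auto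
    have x2: "x * x = to_ac l * x - to_ac al" and y2: "y * y = to_ac m * y - to_ac be"
      using arg_cong[OF xx(1), of "\<lambda>t. x * t"] xx(2) arg_cong[OF yy(1), of "\<lambda>t. y * t"] yy(2)
      by (simp_all add: algebra_simps)
    have iy: "inverse y = y' / to_ac be" "inverse y' = y / to_ac be"
      using nz' unfolding yy(2)[symmetric] by (simp_all add: field_simps)
    obtain k where k: "map_poly to_ac f = [:- z, 1:] * k"
      using z by (auto simp: Root_def poly_eq_0_iff_dvd dvd_def)
    have "[:- z, 1:] * ([:- (x * inverse y'), 1:] * [:- (x' * inverse y), 1:] * [:- (x' * inverse y'), 1:])
        = [:- z, 1:] * (k * map_poly to_ac g)"
      using quot_poly_ac_Root[OF p q xy] unfolding Gac[symmetric] fgac k zxy x'_def[symmetric] y'_def[symmetric]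
      by (simp only: mult.assoc)
    then have H: "[:- (x * inverse y'), 1:] * [:- (x' * inverse y), 1:] * [:- (x' * inverse y'), 1:]
        = k * map_poly to_ac g"
      by (subst (asm) mult_left_cancel) auto
    have fac: "degree (map_poly to_ac f) = degree f" by (subst degree_map_poly) auto
    have k0: "k \<noteq> 0" using k fac df by auto
    then have dk: "degree f = Suc (degree k)"
      using fac unfolding k by (simp add: degree_mult_eq del: mult_pCons_left)
    consider "degree k = 0" | "degree k = 1" using dk df by linarith
    then show False
    proof cases
      case 1
      then obtain k0 where "k = [:k0:]" by (auto elim: degree_eq_zeroE)
      then have "coeff (map_poly to_ac f) 0 = - (z * k0)" "coeff (map_poly to_ac f) 1 = k0" "k0 \<noteq> 0"
        using k \<open>k \<noteq> 0\<close> by auto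
      then have "z = to_ac (- coeff f 0 / coeff f 1)" by (simp add: coeff_map_poly)
      then have "to_ac 0 + to_ac (- 1) * x + to_ac (- coeff f 0 / coeff f 1) * y + to_ac 0 * (x * y) = 0"
        using zxy nz' by (simp add: field_simps)
      then show False using indep[OF xy] by (metis neg_equal_0_iff_equal zero_neq_one)
    next
      case 2
      then obtain k0 k1 where kk: "k = [:k0, k1:]" "k1 \<noteq> 0"
        by (metis degree1_coeffs)
      \<comment> \<open>The root of the linear cofactor \<open>k\<close>; \<open>s\<close> and
        \<open>t\<close> below are the sum and the product of the two roots of
        \<open>f\<close>.\<close>
      define w where "w = - k0 / k1"
      have c: "to_ac (coeff f 0) = - (z * k0)" "to_ac (coeff f 1) = k0 - z * k1" "to_ac (coeff f 2) = k1"
        using arg_cong[OF k, of "\<lambda>f. coeff f 0"] arg_cong[OF k, of "\<lambda>f. coeff f 1"]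
          arg_cong[OF k, of "\<lambda>f. coeff f 2"]
        by (simp_all add: kk coeff_map_poly numeral_2_eq_2)
      define s t where "s = - coeff f 1 / coeff f 2" and "t = coeff f 0 / coeff f 2"
      have st: "z + w = to_ac s" "z * w = to_ac t"
        using kk(2) by (simp_all add: s_def t_def w_def c[unfolded One_nat_def] field_simps)
      have "poly k w = 0" using kk by (simp add: w_def)
      then have "poly ([:- (x * inverse y'), 1:] * [:- (x' * inverse y), 1:] * [:- (x' * inverse y'), 1:]) w = 0"
        unfolding H by simp
      moreover have "w = a \<or> w = b \<or> w = c"
        if "poly ([:- a, 1:] * [:- b, 1:] * [:- c, 1:]) w = 0" for a b c
        using that unfolding poly_mult by auto
      ultimately consider "w = x * inverse y'" | "w = x' * inverse y" | "w = x' * inverse y'"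
        by blast
      then show False
      proof cases
        case 1
        have "to_ac be * (z + w) = x * (y + y')"
          unfolding 1 zxy iy using nz by (simp add: field_simps)
        then have "to_ac (- be * s) + to_ac m * x + to_ac 0 * y + to_ac 0 * (x * y) = 0"
          unfolding st by (simp add: yy algebra_simps)
        then have "m = 0" using indep[OF xy] by blast
        have "x * x = to_ac be * (z * w)"
          unfolding 1 zxy yy(2)[symmetric] using nz' by (simp add: field_simps)
        then have "to_ac (- al - be * t) + to_ac l * x + to_ac 0 * y + to_ac 0 * (x * y) = 0"
          unfolding st x2 by (simp add: algebra_simps)
        then have "l = 0" using indep[OF xy] by blast
        then show False using lm \<open>m = 0\<close> by blast
      next
        case 2
        have "to_ac be * (z + w) = (x + x') * y'"
          unfolding 2 zxy iy using nz by (simp add: field_simps)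
        then have "to_ac (l * m - be * s) + to_ac 0 * x + to_ac (- l) * y + to_ac 0 * (x * y) = 0"
          unfolding st by (simp add: xx yy algebra_simps)
        then have "l = 0" using indep[OF xy] by (metis neg_equal_0_iff_equal)
        have "(z * w) * (y * y) = to_ac al"
          unfolding 2 zxy xx(2)[symmetric] using nz' by (simp add: field_simps)
        then have "to_ac (- al - t * be) + to_ac 0 * x + to_ac (t * m) * y + to_ac 0 * (x * y) = 0"
          unfolding st y2 by (simp add: algebra_simps)
        then have "- al - t * be = 0" "t * m = 0" using indep[OF xy] by blast+
        \<comment> \<open>The first equation and \<open>al \<noteq> 0\<close> give
          \<open>t \<noteq> 0\<close>, so the second one yields \<open>m = 0\<close>.\<close>
        then have "m = 0" using nz by auto
        then show False using lm \<open>l = 0\<close> by blast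
      next
        case 3
        have "to_ac be * (z + w) = x * y' + x' * y"
          unfolding 3 zxy iy using nz by (simp add: field_simps)
        \<comment> \<open>The coefficient of \<open>x y\<close> vanishes in characteristic 2; the
          contradiction comes from those of \<open>x\<close> and \<open>y\<close>, which are the two
          traces.\<close>
        then have "to_ac (- be * s) + to_ac m * x + to_ac l * y + to_ac (- 2) * (x * y) = 0"
          unfolding st by (simp add: xx yy algebra_simps)
        then show False using indep[OF xy] lm by blast
      qed
    qed
  qed
  show ?thesis
  proof (rule Factorial_Ring.irreducibleI)
    show G0: "?G \<noteq> 0" using G4 by auto
    show "\<not> is_unit ?G" using G4 G0 by (simp add: is_unit_iff_degree)
    fix f g assume fg: "?G = f * g"
    then have n0: "f \<noteq> 0" "g \<noteq> 0" using G0 by auto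
    then have "degree f + degree g = 4" using G4 fg by (simp add: degree_mult_eq)
    then have "degree f = 0 \<or> degree g = 0"
      using no_factor[OF fg] no_factor[of g f] fg by (cases "degree f \<le> 2") (auto simp: mult.commute)
    then show "is_unit f \<or> is_unit g" using n0 by (auto simp: is_unit_iff_degree)
  qed
qed

section \<open>Polynomials in an endomorphism\<close>

text \<open>By division with remainder, a nonzero element of least degree in the ideal generated by
  \<open>f\<close> and \<open>g\<close> divides both; irreducibility of \<open>g\<close> leaves only
  a unit.\<close>

lemma irreducible_poly_bezout:
  fixes f g :: "'a::field poly"
  assumes "Factorial_Ring.irreducible g" "\<not> g dvd f"
  obtains a b where "a * f + b * g = 1"
proof -
  define I where "I = {h. h \<noteq> 0 \<and> (\<exists>a b. h = a * f + b * g)}"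
  have "g \<in> I" using assms(1) by (auto simp: I_def intro: exI[of _ 0] exI[of _ 1])
  then obtain h where h: "h \<in> I" and least: "\<And>k. k \<in> I \<Longrightarrow> degree h \<le> degree k"
    using ex_has_least_nat[of "\<lambda>h. h \<in> I" g degree] by blast
  obtain a b where ab: "h = a * f + b * g" using h by (auto simp: I_def)
  have dvd: "h dvd k" if k: "k = c * f + d * g" for k c d
  proof -
    have "k mod h = (c - (k div h) * a) * f + (d - (k div h) * b) * g"
      unfolding minus_div_mult_eq_mod[symmetric] k by (simp add: ab algebra_simps)
    moreover have "degree (k mod h) < degree h \<or> k mod h = 0"
      using degree_mod_less[of h k] h by (auto simp: I_def)
    ultimately have "k mod h = 0"
      using least[of "k mod h"] unfolding I_def mem_Collect_eq by (metis not_le)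
    then show ?thesis by auto
  qed
  have "h dvd f" using dvd[of f 1 0] by simp
  have "h dvd g" using dvd[of g 0 1] by simp
  then obtain e where e: "g = h * e" unfolding dvd_def by blast
  then have "is_unit h \<or> is_unit e" using assms(1) by (metis Factorial_Ring.irreducibleD)
  moreover have "\<not> is_unit e"
  proof
    assume "is_unit e"
    then have "g dvd h" using e by (simp add: mult_unit_dvd_iff)
    then show False using \<open>h dvd f\<close> assms(2) dvd_trans by blast
  qed
  ultimately obtain c where "1 = h * c" unfolding dvd_def by blast
  then have "(c * a) * f + (c * b) * g = 1" by (simp add: ab algebra_simps)
  then show ?thesis by (rule that)
qed

lemma irreducible_poly_bezout_power:
  fixes f g :: "'a::field poly"
  assumes "Factorial_Ring.irreducible g" "\<not> g dvd f"
  obtains a b where "a * f + b * g ^ n = 1"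
proof -
  have "\<exists>a b. a * f + b * g ^ n = 1"
  proof (induction n)
    case 0
    show ?case by (rule exI[of _ 0], rule exI[of _ 1]) simp
  next
    case (Suc n)
    then obtain a b where ab: "a * f + b * g ^ n = 1" by blast
    obtain c d where cd: "c * f + d * g = 1" using irreducible_poly_bezout[OF assms] .
    have "1 = (a * f + b * g ^ n) * (c * f + d * g)" by (simp add: ab cd)
    also have "\<dots> = (a * (c * f + d * g) + b * g ^ n * c) * f + (b * d) * g ^ Suc n"
      by (simp add: algebra_simps)
    finally show ?case by metis
  qed
  then show ?thesis using that by blast
qed

text \<open>If \<open>g\<close> divides \<open>f\<close>, one factor is cancelled; otherwise Bezout
  shows that \<open>f\<close> already divides the next lower power. Monicity removes the ambiguity
  up to units.\<close>

lemma irreducible_poly_dvd_power: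
  fixes f g :: "'a::field poly"
  assumes "Factorial_Ring.irreducible g" "lead_coeff g = 1" "lead_coeff f = 1" "f dvd g ^ n"
  shows "\<exists>k\<le>n. f = g ^ k"
  using assms(3,4)
proof (induction n arbitrary: f)
  case 0
  then have "degree f = 0" by (simp add: is_unit_iff_degree poly_dvd_1 dvd_imp_degree_le)
  then have "f = 1" using 0 by (auto elim: degree_eq_zeroE)
  then show ?case by auto
next
  case (Suc n)
  show ?case
  proof (cases "g dvd f")
    case True
    then obtain h where h: "f = g * h" unfolding dvd_def by blast
    have "g \<noteq> 0" using assms by auto
    then have "h dvd g ^ n" using Suc.prems h by simp
    moreover have "lead_coeff h = 1" using Suc.prems(1) h assms(2) by (simp add: lead_coeff_mult)
    ultimately obtain k where "k \<le> n" "h = g ^ k" using Suc.IH by blast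
    then show ?thesis using h by (intro exI[of _ "Suc k"]) auto
  next
    case False
    then obtain a b where "a * f + b * g = 1" using irreducible_poly_bezout[OF assms(1)] by blast
    then have "g ^ n = (a * f + b * g) * g ^ n" by simp
    also have "\<dots> = a * g ^ n * f + b * g ^ Suc n" by (simp add: algebra_simps)
    finally have "g ^ n = a * g ^ n * f + b * g ^ Suc n" .
    then have "f dvd g ^ n" using Suc.prems(2) by (metis dvd_add dvd_mult dvd_triv_right)
    then show ?thesis using Suc.IH Suc.prems(1) by (metis le_SucI)
  qed
qed

lemma poly_end_upto:
  assumes "vector_space s" "degree f \<le> n"
  shows "poly_end s f u v = (\<Sum>i\<le>n. s (coeff f i) ((u ^^ i) v))"
proof -
  interpret vector_space s by fact
  show ?thesis unfolding poly_end_def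
    by (rule sum.mono_neutral_left) (use assms(2) in \<open>auto simp: coeff_eq_0\<close>)
qed

section \<open>The module structure over the polynomial ring\<close>

locale endomorphism = vector_space s
  for s :: "'a::field \<Rightarrow> 'v::ab_group_add \<Rightarrow> 'v" +
  fixes u :: "'v \<Rightarrow> 'v"
  assumes linear_u: "Vector_Spaces.linear s s u"
begin

lemma u_simps [simp]:
  shows u_add: "u (x + y) = u x + u y" and u_scale: "u (s c x) = s c (u x)" and u_0: "u 0 = 0"
    and u_diff: "u (x - y) = u x - u y" and u_minus: "u (- x) = - u x"
proof -
  interpret Vector_Spaces.linear s s u by (rule linear_u)
  show "u (x + y) = u x + u y" "u (s c x) = s c (u x)" "u 0 = 0" "u (x - y) = u x - u y"
    "u (- x) = - u x" by (simp_all add: add scale diff neg)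
qed

lemma u_sum: "u (sum f A) = (\<Sum>i\<in>A. u (f i))"
proof -
  interpret Vector_Spaces.linear s s u by (rule linear_u)
  show ?thesis by (rule sum)
qed

abbreviation act :: "'a poly \<Rightarrow> 'v \<Rightarrow> 'v" (infixr "\<star>" 75) where
  "f \<star> v \<equiv> poly_end s f u v"

lemmas act_upto = poly_end_upto[OF vector_space_axioms]

lemma act_add_poly: "(f + g) \<star> v = f \<star> v + g \<star> v"
  by (subst (1 2 3) act_upto[of _ "max (degree f) (degree g)"])
    (auto simp: degree_add_le scale_left_distrib sum.distrib)

lemma act_pCons: "pCons a f \<star> v = s a v + u (f \<star> v)"
proof -
  have "pCons a f \<star> v = (\<Sum>i\<le>Suc (degree f). s (coeff (pCons a f) i) ((u ^^ i) v))"
    by (rule act_upto) (simp add: degree_pCons_le)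
  also have "\<dots> = s a v + u (f \<star> v)"
    by (subst sum.atMost_Suc_shift) (simp add: u_sum poly_end_def)
  finally show ?thesis .
qed

lemma act_0_poly: "0 \<star> v = 0"
  by (simp add: poly_end_def)

lemma act_add: "f \<star> (v + w) = f \<star> v + f \<star> w"
  by (induction f) (simp_all add: act_pCons act_0_poly scale_right_distrib)

lemma act_scale: "f \<star> s c v = s c (f \<star> v)"
  by (induction f) (simp_all add: act_pCons act_0_poly scale_right_distrib scale_left_commute)

lemma act_smult: "smult c f \<star> v = s c (f \<star> v)"
  by (induction f) (simp_all add: act_pCons act_0_poly scale_right_distrib)

lemma act_mult: "(f * g) \<star> v = f \<star> g \<star> v"
  by (induction f) (simp_all add: act_pCons act_0_poly act_add_poly act_smult)

lemma act_1: "1 \<star> v = v"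
  by (simp add: poly_end_def)

sublocale poly_module: Modules.module act
  by unfold_locales (simp_all add: act_add act_add_poly act_mult act_1)

lemma act_X: "[:0, 1:] \<star> v = u v"
  by (simp add: act_pCons)

lemma act_u: "f \<star> u v = u (f \<star> v)"
  by (induction f) (simp_all add: act_pCons)

lemma act_monom: "monom c i \<star> v = s c ((u ^^ i) v)"
  by (induction i) (simp_all add: monom_Suc act_pCons monom_0)

lemma funpow_u_diff_scale: "(u ^^ i) (v + w) = (u ^^ i) v + (u ^^ i) w"
    "(u ^^ i) (s c v) = s c ((u ^^ i) v)"
  by (induction i) simp_all

lemma act_less:
  assumes "degree f < n \<or> f = 0"
  shows "f \<star> v = (\<Sum>i<n. s (coeff f i) ((u ^^ i) v))"
proof (cases n)
  case 0
  then show ?thesis using assms by simp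
next
  case (Suc m)
  then show ?thesis using assms act_upto[of f m] by (auto simp: lessThan_Suc_atMost)
qed

lemma act_intertwine:
  assumes T: "Vector_Spaces.linear s s T" and eq: "\<And>x. T (u x) = U (T x)"
  shows "T (f \<star> x) = poly_end s f U (T x)"
proof -
  interpret Vector_Spaces.linear s s T by fact
  have "T ((u ^^ i) x) = (U ^^ i) (T x)" for i by (induction i) (simp_all add: eq)
  then show ?thesis by (simp add: poly_end_def sum scale)
qed

lemma act_mod:
  assumes "r \<star> v = 0"
  shows "(f mod r) \<star> v = f \<star> v"
proof -
  have "f \<star> v = (f div r * r + f mod r) \<star> v" by simp
  also have "\<dots> = (f mod r) \<star> v" by (simp only: act_add_poly act_mult assms) simp
  finally show ?thesis by simp
qed

text \<open>The Bezout coefficient of \<open>f\<close> modulo \<open>g ^ n\<close> inverts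
  \<open>f\<close> on the kernel of \<open>g ^ n\<close>. This inverse is itself a polynomial in
  \<open>u\<close>, so it commutes with \<open>u\<close> and preserves every
  \<open>u\<close>-invariant subspace.\<close>

lemma act_inverse:
  assumes "Factorial_Ring.irreducible g" "\<not> g dvd f"
  obtains a where "\<And>x. (g ^ n) \<star> x = 0 \<Longrightarrow> a \<star> f \<star> x = x"
proof -
  obtain a b where ab: "a * f + b * g ^ n = 1" using irreducible_poly_bezout_power[OF assms] .
  have "a \<star> f \<star> x = x" if "(g ^ n) \<star> x = 0" for x
  proof -
    have "(a * f + b * g ^ n) \<star> x = x" by (simp add: ab act_1)
    then show ?thesis by (simp only: act_add_poly act_mult that) simp
  qed
  then show ?thesis by (rule that)
qed

lemma subspace_act:
  assumes "subspace W" "\<And>x. x \<in> W \<Longrightarrow> u x \<in> W" "x \<in> W"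
  shows "f \<star> x \<in> W"
  using assms by (induction f) (auto simp: act_pCons subspace_0 subspace_add subspace_scale)

section \<open>Chains and companion matrices\<close>

definition chain :: "'v \<Rightarrow> nat \<Rightarrow> 'v list" where
  "chain v d = map (\<lambda>i. (u ^^ i) v) [0..<d]"

lemma length_chain [simp]: "length (chain v d) = d"
  by (simp add: chain_def)

lemma set_chain: "set (chain v d) = (\<lambda>i. (u ^^ i) v) ` {..<d}"
  by (auto simp: chain_def)

lemma nth_chain [simp]: "i < d \<Longrightarrow> chain v d ! i = (u ^^ i) v"
  by (simp add: chain_def)

text \<open>The matrix equation of \<open>represents\<close> without the requirement of a basis: it
  can be checked block by block, whereas independence concerns the list as a whole.\<close>

definition rep :: "'v list \<Rightarrow> 'a mat \<Rightarrow> bool" where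
  "rep bs M \<longleftrightarrow> M \<in> carrier_mat (length bs) (length bs) \<and>
     (\<forall>j<length bs. u (bs ! j) = (\<Sum>i<length bs. s (M $$ (i, j)) (bs ! i)))"

lemma represents_iff_rep: "represents s u bs M \<longleftrightarrow> is_basis s bs \<and> rep bs M"
  by (simp add: represents_def rep_def)

lemma rep_four_block:
  assumes A: "A \<in> carrier_mat (length as) (length as)" and B: "B \<in> carrier_mat (length bs) (length bs)"
  shows "rep (as @ bs) (four_block_mat A (0\<^sub>m (length as) (length bs)) (0\<^sub>m (length bs) (length as)) B)
    \<longleftrightarrow> rep as A \<and> rep bs B" (is "rep _ ?M \<longleftrightarrow> _")
proof -
  let ?n = "length as" and ?m = "length bs"
  have split: "(\<Sum>i<?n + k. f i) = (\<Sum>i<?n. f i) + (\<Sum>i<k. f (?n + i))" for f :: "nat \<Rightarrow> 'v" and k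
    by (induction k) (simp_all add: add.assoc)
  have *: "(\<Sum>i<?n + ?m. s (?M $$ (i, j)) ((as @ bs) ! i)) =
      (if j < ?n then \<Sum>i<?n. s (A $$ (i, j)) (as ! i) else \<Sum>i<?m. s (B $$ (i, j - ?n)) (bs ! i))"
    if "j < ?n + ?m" for j
    unfolding split using that A B by (auto simp: nth_append intro!: sum.neutral)
  have all_split: "(\<forall>j<?n + ?m. P j) \<longleftrightarrow> (\<forall>j<?n. P j) \<and> (\<forall>j<?m. P (?n + j))" for P
  proof safe
    fix j assume "\<forall>j<?n. P j" "\<forall>j<?m. P (?n + j)" "j < ?n + ?m"
    then show "P j" by (cases "j < ?n") (auto dest: spec[of _ "j - ?n"])
  qed auto
  have "rep (as @ bs) ?M \<longleftrightarrow> (\<forall>j<?n + ?m. u ((as @ bs) ! j) =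
     (if j < ?n then \<Sum>i<?n. s (A $$ (i, j)) (as ! i) else \<Sum>i<?m. s (B $$ (i, j - ?n)) (bs ! i)))"
    unfolding rep_def length_append using A B * by auto
  also have "\<dots> \<longleftrightarrow> rep as A \<and> rep bs B"
    unfolding all_split rep_def using A B by (auto simp: nth_append)
  finally show ?thesis .
qed

text \<open>The ones below the diagonal make the list a chain, and the last column says that
  \<open>r\<close> annihilates its first vector. For \<open>r = 1\<close> the list is empty and the
  witness is the zero vector.\<close>

lemma rep_companion:
  assumes r: "lead_coeff r = 1"
  shows "rep bs (companion r) \<longleftrightarrow> (\<exists>v. bs = chain v (degree r) \<and> r \<star> v = 0)"
proof (cases "degree r")
  case 0
  then have "r = 1" using r by (auto elim: degree_eq_zeroE)
  then show ?thesis by (auto simp: rep_def companion_def chain_def act_1)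
next
  case (Suc d)
  have last: "r \<star> v = (\<Sum>i<Suc d. s (coeff r i) ((u ^^ i) v)) + u ((u ^^ d) v)" for v
    using r Suc by (simp add: poly_end_def lessThan_Suc_atMost[symmetric])
  have sum1: "(\<Sum>i<Suc d. s (companion r $$ (i, j)) (bs ! i)) =
      (if j = d then \<Sum>i<Suc d. s (- coeff r i) (bs ! i) else bs ! Suc j)" if "j < Suc d" for j and bs :: "'v list"
  proof (cases "j = d")
    case True
    then show ?thesis using Suc by (auto simp: companion_def intro!: sum.cong)
  next
    case False
    have "(\<Sum>i<Suc d. s (companion r $$ (i, j)) (bs ! i)) = (\<Sum>i<Suc d. if i = Suc j then bs ! i else 0)"
      using False that Suc by (intro sum.cong) (auto simp: companion_def)
    also have "\<dots> = bs ! Suc j" using False that by (subst sum.delta) auto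
    finally show ?thesis using False by simp
  qed
  have "rep bs (companion r) \<longleftrightarrow> length bs = Suc d \<and> (\<forall>j<d. u (bs ! j) = bs ! Suc j) \<and>
      u (bs ! d) = (\<Sum>i<Suc d. s (- coeff r i) (bs ! i))"
  proof -
    have "companion r \<in> carrier_mat (length bs) (length bs) \<longleftrightarrow> length bs = Suc d"
      using Suc by (auto simp: companion_def)
    then show ?thesis
      unfolding rep_def using sum1[of _ bs] by (auto simp: less_Suc_eq simp del: sum.lessThan_Suc)
  qed
  also have "\<dots> \<longleftrightarrow> (\<exists>v. bs = chain v (Suc d) \<and> r \<star> v = 0)"
  proof safe
    assume len: "length bs = Suc d" and step: "\<forall>j<d. u (bs ! j) = bs ! Suc j"
      and lst: "u (bs ! d) = (\<Sum>i<Suc d. s (- coeff r i) (bs ! i))"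
    have nth: "bs ! j = (u ^^ j) (bs ! 0)" if "j < Suc d" for j
      using that step by (induction j) auto
    have "bs = chain (bs ! 0) (Suc d)"
    proof (rule nth_equalityI)
      fix j assume "j < length bs"
      then show "bs ! j = chain (bs ! 0) (Suc d) ! j" using nth[of j] len by simp
    qed (simp add: len)
    moreover have "r \<star> (bs ! 0) = 0"
    proof -
      have "u (bs ! d) = - (\<Sum>i<Suc d. s (coeff r i) ((u ^^ i) (bs ! 0)))"
        unfolding lst sum_negf[symmetric] by (rule sum.cong) (auto simp: nth[symmetric])
      then show ?thesis unfolding last nth[of d, OF lessI] by simp
    qed
    ultimately show "\<exists>v. bs = chain v (Suc d) \<and> r \<star> v = 0" by blast
  next
    fix v assume "r \<star> v = 0"
    then have "u ((u ^^ d) v) = - (\<Sum>i<Suc d. s (coeff r i) ((u ^^ i) v))"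
      unfolding last by (metis add.commute eq_neg_iff_add_eq_0)
    then show "u (chain v (Suc d) ! d) = (\<Sum>i<Suc d. s (- coeff r i) (chain v (Suc d) ! i))"
      by (simp add: sum_negf del: sum.lessThan_Suc)
  qed auto
  finally show ?thesis using Suc by simp
qed

definition cyclic_list :: "('v \<times> 'a poly) list \<Rightarrow> 'v list" where
  "cyclic_list xs = concat (map (\<lambda>(v, r). chain v (degree r)) xs)"

text \<open>Each \<open>r\<close> is only a multiple of the order of its vector; it is the order
  itself once \<open>cyclic_list xs\<close> is a basis, by \<open>cyclic_list_dvd\<close>.\<close>

definition annihilated :: "('v \<times> 'a poly) list \<Rightarrow> bool" where
  "annihilated xs \<longleftrightarrow> (\<forall>(v, r)\<in>set xs. lead_coeff r = 1 \<and> r \<star> v = 0)"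

lemma rep_diag_companion:
  assumes "\<forall>r\<in>set rs. lead_coeff r = 1"
  shows "rep bs (diag_block_mat (map companion rs)) \<longleftrightarrow>
    (\<exists>xs. map snd xs = rs \<and> annihilated xs \<and> bs = cyclic_list xs)"
  using assms
proof (induction rs arbitrary: bs)
  case Nil
  show ?case by (auto simp: rep_def annihilated_def cyclic_list_def)
next
  case (Cons r rs)
  let ?D = "diag_block_mat (map companion rs)"
  define m where "m = sum_list (map degree rs)"
  have dims: "?D \<in> carrier_mat m m"
    by (auto simp: dim_diag_block_mat companion_def comp_def m_def)
  have cr: "companion r \<in> carrier_mat (degree r) (degree r)" by (simp add: companion_def)
  have *: "diag_block_mat (map companion (r # rs)) =
      four_block_mat (companion r) (0\<^sub>m (degree r) m) (0\<^sub>m m (degree r)) ?D"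
    using dims cr by (auto simp: Let_def)
  have "rep bs (diag_block_mat (map companion (r # rs))) \<longleftrightarrow>
      (\<exists>as cs. bs = as @ cs \<and> rep as (companion r) \<and> rep cs ?D)"
  proof
    assume rep: "rep bs (diag_block_mat (map companion (r # rs)))"
    then have len: "length bs = degree r + m" using dims cr unfolding * rep_def by auto
    have "bs = take (degree r) bs @ drop (degree r) bs" by simp
    moreover have "rep (take (degree r) bs) (companion r) \<and> rep (drop (degree r) bs) ?D"
      using rep_four_block[of "companion r" "take (degree r) bs" ?D "drop (degree r) bs"] rep len dims cr
      unfolding * by auto
    ultimately show "\<exists>as cs. bs = as @ cs \<and> rep as (companion r) \<and> rep cs ?D" by blast
  next
    assume "\<exists>as cs. bs = as @ cs \<and> rep as (companion r) \<and> rep cs ?D"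
    then obtain as cs where ac: "bs = as @ cs" "rep as (companion r)" "rep cs ?D" by blast
    then have "length as = degree r" "length cs = m" using cr dims by (auto simp: rep_def)
    then show "rep bs (diag_block_mat (map companion (r # rs)))"
      using rep_four_block[of "companion r" as ?D cs] ac cr dims unfolding * by auto
  qed
  also have "\<dots> \<longleftrightarrow> (\<exists>v xs. r \<star> v = 0 \<and> map snd xs = rs \<and> annihilated xs \<and>
      bs = chain v (degree r) @ cyclic_list xs)"
    using Cons by (auto simp: rep_companion)
  also have "\<dots> \<longleftrightarrow> (\<exists>xs. map snd xs = r # rs \<and> annihilated xs \<and> bs = cyclic_list xs)"
  proof
    assume "\<exists>v xs. r \<star> v = 0 \<and> map snd xs = rs \<and> annihilated xs \<and>
      bs = chain v (degree r) @ cyclic_list xs"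
    then obtain v xs where "r \<star> v = 0" "map snd xs = rs" "annihilated xs"
      "bs = chain v (degree r) @ cyclic_list xs" by blast
    then show "\<exists>xs. map snd xs = r # rs \<and> annihilated xs \<and> bs = cyclic_list xs"
      using Cons.prems by (intro exI[of _ "(v, r) # xs"]) (auto simp: annihilated_def cyclic_list_def)
  next
    assume "\<exists>xs. map snd xs = r # rs \<and> annihilated xs \<and> bs = cyclic_list xs"
    then obtain v xs where "map snd ((v, r) # xs) = r # rs" "annihilated ((v, r) # xs)"
      "bs = cyclic_list ((v, r) # xs)" by (auto simp: map_eq_Cons_conv)
    then show "\<exists>v xs. r \<star> v = 0 \<and> map snd xs = rs \<and> annihilated xs \<and>
      bs = chain v (degree r) @ cyclic_list xs"
      by (intro exI[of _ v] exI[of _ xs]) (auto simp: annihilated_def cyclic_list_def)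
  qed
  finally show ?case .
qed

lemma represents_diag_companion:
  assumes "\<forall>r\<in>set rs. lead_coeff r = 1"
  shows "(\<exists>bs. represents s u bs (diag_block_mat (map companion rs))) \<longleftrightarrow>
    (\<exists>xs. map snd xs = rs \<and> annihilated xs \<and> is_basis s (cyclic_list xs))"
  unfolding represents_iff_rep rep_diag_companion[OF assms] by blast

end

lemma diag_block_mat_concat: "diag_block_mat (map diag_block_mat Ass) = diag_block_mat (concat Ass)"
proof (induction Ass)
  case (Cons As Ass)
  show ?case unfolding concat.simps diag_block_mat_append by (simp add: Cons.IH Let_def)
qed simp

text \<open>A tuple \<open>(v, n, v', n')\<close> stands for one block of condition (iii): two
  generators with the exponents of their orders. The constraint between \<open>n\<close> and
  \<open>n'\<close> is imposed separately.\<close>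

definition pair_list :: "'a::field poly \<Rightarrow> ('v \<times> nat \<times> 'v \<times> nat) list \<Rightarrow> ('v \<times> 'a poly) list" where
  "pair_list G ps = concat (map (\<lambda>(v, n, v', n'). [(v, G ^ n), (v', G ^ n')]) ps)"

section \<open>Splitting off cyclic submodules\<close>

locale fd_endomorphism = endomorphism s u + finite_dimensional_vector_space s Basis
  for s :: "'a::field \<Rightarrow> 'v::ab_group_add \<Rightarrow> 'v" and u :: "'v \<Rightarrow> 'v" and Basis :: "'v set"
begin

section \<open>Dimension counts with chains and functionals\<close>

lemma span_chain: "span (set (chain v d)) \<subseteq> {f \<star> v | f. f = 0 \<or> degree f < d}"
proof (rule span_minimal)
  show "set (chain v d) \<subseteq> {f \<star> v | f. f = 0 \<or> degree f < d}"
  proof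
    fix x assume "x \<in> set (chain v d)"
    then obtain i where "i < d" "x = (u ^^ i) v" by (auto simp: set_chain)
    then have "x = monom 1 i \<star> v" "degree (monom (1::'a) i) < d"
      by (simp_all add: act_monom degree_monom_eq)
    then show "x \<in> {f \<star> v | f. f = 0 \<or> degree f < d}" by blast
  qed
  show "subspace {f \<star> v | f. f = 0 \<or> degree f < d}"
  proof (rule subspaceI)
    show "0 \<in> {f \<star> v | f. f = 0 \<or> degree f < d}" by (auto intro: exI[of _ 0])
  next
    fix x y assume "x \<in> {f \<star> v | f. f = 0 \<or> degree f < d}" "y \<in> {f \<star> v | f. f = 0 \<or> degree f < d}"
    then obtain f g where fg: "x = f \<star> v" "y = g \<star> v" "f = 0 \<or> degree f < d" "g = 0 \<or> degree g < d"
      by blast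
    have "x + y = (f + g) \<star> v" by (simp add: fg act_add_poly)
    moreover have "f + g = 0 \<or> degree (f + g) < d"
      using fg(3,4) by (auto intro: degree_add_less)
    ultimately show "x + y \<in> {f \<star> v | f. f = 0 \<or> degree f < d}" by blast
  next
    fix c x assume "x \<in> {f \<star> v | f. f = 0 \<or> degree f < d}"
    then obtain f where f: "x = f \<star> v" "f = 0 \<or> degree f < d" by blast
    have "s c x = smult c f \<star> v" by (simp add: f act_smult)
    moreover have "smult c f = 0 \<or> degree (smult c f) < d" using f(2) by auto
    ultimately show "s c x \<in> {f \<star> v | f. f = 0 \<or> degree f < d}" by blast
  qed
qed

text \<open>A dependence of \<open>(u ^^ d) v\<close> on \<open>W\<close> and the shorter chain
  would be a monic polynomial of degree \<open>d\<close> carrying \<open>v\<close> into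
  \<open>W\<close>.\<close>

lemma dim_Un_chain:
  assumes W: "subspace W" and ge: "\<And>f. f \<star> v \<in> W \<Longrightarrow> f = 0 \<or> d \<le> degree f"
  shows "dim (W \<union> set (chain v d)) = dim W + d"
  using ge
proof (induction d)
  case 0
  show ?case by (simp add: chain_def)
next
  case (Suc d)
  have "(u ^^ d) v \<notin> span (W \<union> set (chain v d))"
  proof
    assume "(u ^^ d) v \<in> span (W \<union> set (chain v d))"
    then obtain w y where wy: "(u ^^ d) v = w + y" "w \<in> span W" "y \<in> span (set (chain v d))"
      unfolding span_Un by blast
    then obtain f where f: "y = f \<star> v" "f = 0 \<or> degree f < d" using span_chain by blast
    have "(monom 1 d - f) \<star> v = w"
      by (simp add: poly_module.scale_left_diff_distrib act_monom wy(1) f(1))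
    then have "(monom 1 d - f) \<star> v \<in> W" using wy(2) span_eq_iff[THEN iffD2, OF W] by simp
    then have "monom 1 d - f = 0 \<or> Suc d \<le> degree (monom 1 d - f)" by (rule Suc.prems)
    moreover have "coeff (monom 1 d - f) d = 1" using f(2) by (auto simp: coeff_eq_0)
    moreover have "degree (monom 1 d - f) \<le> d"
      using f(2) by (intro degree_diff_le) (auto simp: degree_monom_le)
    ultimately show False by auto
  qed
  moreover have "W \<union> set (chain v (Suc d)) = insert ((u ^^ d) v) (W \<union> set (chain v d))"
    by (auto simp: set_chain lessThan_Suc)
  moreover have "dim (W \<union> set (chain v d)) = dim W + d"
    using Suc.prems by (intro Suc.IH) (meson Suc_leD)
  ultimately show ?case by (simp add: dim_insert)
qed

lemma dim_kernel_functional: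
  assumes S: "subspace S" and f: "Vector_Spaces.linear s (*) f"
  shows "dim S \<le> dim {w \<in> S. f w = 0} + 1"
proof (cases "\<forall>w\<in>S. f w = 0")
  case True
  then have "{w \<in> S. f w = 0} = S" by auto
  then show ?thesis by simp
next
  case False
  then obtain x where x: "x \<in> S" "f x \<noteq> 0" by blast
  interpret f: Vector_Spaces.linear s "(*)" f by fact
  have "S \<subseteq> span (insert x {w \<in> S. f w = 0})"
  proof
    fix y assume y: "y \<in> S"
    have "f (y - s (f y / f x) x) = 0" using x by (simp add: f.diff f.scale)
    moreover have "y - s (f y / f x) x \<in> S" using S x y by (auto intro: subspace_diff subspace_scale)
    ultimately have "y - s (f y / f x) x \<in> span {w \<in> S. f w = 0}" by (simp add: span_base)
    then show "y \<in> span (insert x {w \<in> S. f w = 0})" unfolding span_insert by blast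
  qed
  then have "dim S \<le> dim (insert x {w \<in> S. f w = 0})" by (rule dim_mono)
  also have "\<dots> \<le> dim {w \<in> S. f w = 0} + 1" by (simp add: dim_insert)
  finally show ?thesis .
qed

lemma subspace_kernel_functionals:
  assumes "subspace S" "\<forall>f\<in>A. Vector_Spaces.linear s (*) f"
  shows "subspace {w \<in> S. \<forall>f\<in>A. f w = 0}"
proof (rule subspaceI)
  have *: "f (x + y) = f x + f y" "f (s c x) = c * f x" "f 0 = 0" if "f \<in> A" for f c x y
  proof -
    interpret f: Vector_Spaces.linear s "(*)" f using assms(2) that by blast
    show "f (x + y) = f x + f y" "f (s c x) = c * f x" "f 0 = 0" by (simp_all add: f.add f.scale)
  qed
  show "0 \<in> {w \<in> S. \<forall>f\<in>A. f w = 0}" using * assms(1) by (simp add: subspace_0)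
  show "x + y \<in> {w \<in> S. \<forall>f\<in>A. f w = 0}"
    if "x \<in> {w \<in> S. \<forall>f\<in>A. f w = 0}" "y \<in> {w \<in> S. \<forall>f\<in>A. f w = 0}" for x y
    using that assms(1) by (auto simp: subspace_add) (metis *(1) add.right_neutral)
  show "s c x \<in> {w \<in> S. \<forall>f\<in>A. f w = 0}" if "x \<in> {w \<in> S. \<forall>f\<in>A. f w = 0}" for c x
    using that assms(1) by (auto simp: subspace_scale) (metis *(2) mult_zero_right)
qed

text \<open>Serves to bound the codimension of the complement in \<open>split_cyclic\<close> by the
  number of linear conditions that cut it out.\<close>

lemma dim_kernel_functionals:
  assumes S: "subspace S" and "\<forall>f\<in>set fs. Vector_Spaces.linear s (*) f"
  shows "dim S \<le> dim {w \<in> S. \<forall>f\<in>set fs. f w = 0} + length fs"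
  using assms(2)
proof (induction fs)
  case (Cons f fs)
  let ?K = "{w \<in> S. \<forall>f\<in>set fs. f w = 0}"
  have "dim S \<le> dim ?K + length fs" using Cons by simp
  also have "dim ?K \<le> dim {w \<in> ?K. f w = 0} + 1"
    using Cons.prems S by (intro dim_kernel_functional subspace_kernel_functionals) auto
  also have "{w \<in> ?K. f w = 0} = {w \<in> S. \<forall>f\<in>set (f # fs). f w = 0}" by auto
  finally show ?case by simp
qed simp

text \<open>The coordinate along \<open>x\<close> in a basis that extends
  \<open>{x}\<close>.\<close>

lemma ex_functional:
  assumes "x \<noteq> 0" obtains f where "Vector_Spaces.linear s (*) f" "f x \<noteq> 0"
proof -
  define B where "B = extend_basis {x}"
  have ind: "independent {x}" using assms by simp
  have B: "independent B" "span B = UNIV" "{x} \<subseteq> B"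
    using independent_extend_basis[OF ind] span_extend_basis[OF ind] extend_basis_superset[OF ind]
    by (auto simp: B_def)
  have "vector_space ((*) :: 'a \<Rightarrow> _)" by unfold_locales (simp_all add: algebra_simps)
  then have "Vector_Spaces.linear s (*) (\<lambda>y. representation B y x)"
    using B by (simp add: Vector_Spaces.linear_iff representation_add representation_scale vector_space_axioms)
  moreover have "representation B x x \<noteq> 0"
    using representation_basis[OF B(1), of x] B(3) by auto
  ultimately show ?thesis by (rule that)
qed

end

text \<open>
  For a \<open>(p, q)\<close>-quotient \<open>u = a b\<^sup>-\<^sup>1\<close>, the commutator \<open>u a - a u\<close> is such an operator \<open>C\<close>, with
  \<open>\<delta> = p(0) / q(0)\<close> and \<open>\<alpha> = p(0)\<close>.
\<close>
locale twisted_endomorphism = fd_endomorphism s u Basis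
  for s :: "'a::field \<Rightarrow> 'v::ab_group_add \<Rightarrow> 'v" and u :: "'v \<Rightarrow> 'v" and Basis :: "'v set" +
  fixes C :: "'v \<Rightarrow> 'v" and \<delta> \<alpha> :: 'a and G :: "'a poly" and N :: nat
  assumes linear_C: "Vector_Spaces.linear s s C"
    and uCu: "u (C (u x)) = s \<delta> (C x)"
    and uuCC: "u (u (C (C x))) = s \<alpha> (G \<star> x)"
    and \<delta>_nz: "\<delta> \<noteq> 0" and \<alpha>_nz: "\<alpha> \<noteq> 0"
    and irreducible_G: "Factorial_Ring.irreducible G"
    and monic_G: "lead_coeff G = 1"
    and not_dvd_X: "\<not> G dvd [:0, 1:]"
    and power_G_act: "(G ^ N) \<star> x = 0"
begin

section \<open>Membership in invariant subspaces under powers of \<open>C\<close>\<close>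

lemma C_simps [simp]:
  shows C_add: "C (x + y) = C x + C y" and C_scale: "C (s c x) = s c (C x)" and C_0: "C 0 = 0"
proof -
  interpret Vector_Spaces.linear s s C by (rule linear_C)
  show "C (x + y) = C x + C y" "C (s c x) = s c (C x)" "C 0 = 0" by (simp_all add: add scale)
qed

lemma Cpow_simps [simp]:
  shows Cpow_add: "(C ^^ l) (x + y) = (C ^^ l) x + (C ^^ l) y"
    and Cpow_scale: "(C ^^ l) (s c x) = s c ((C ^^ l) x)" and Cpow_0: "(C ^^ l) 0 = 0"
  by (induction l) simp_all

lemma u_mem_iff:
  assumes "subspace W" "\<And>x. x \<in> W \<Longrightarrow> u x \<in> W"
  shows "u x \<in> W \<longleftrightarrow> x \<in> W"
proof
  obtain a where "\<And>x. (G ^ N) \<star> x = 0 \<Longrightarrow> a \<star> [:0, 1:] \<star> x = x"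
    using act_inverse[OF irreducible_G not_dvd_X] by blast
  then have "a \<star> u x = x" by (simp add: power_G_act act_X)
  then show "x \<in> W" if "u x \<in> W" using subspace_act[OF assms that, of a] by simp
qed (rule assms)

lemma scale_mem_iff: "subspace W \<Longrightarrow> c \<noteq> 0 \<Longrightarrow> s c x \<in> W \<longleftrightarrow> x \<in> W"
  using subspace_scale[of W "s c x" "1 / c"] by (auto intro: subspace_scale)

context
  fixes W assumes W: "subspace W" and u_W: "\<And>x. x \<in> W \<Longrightarrow> u x \<in> W"
begin

lemma Cpow_u_mem_iff: "(C ^^ l) (u x) \<in> W \<longleftrightarrow> (C ^^ l) x \<in> W"
proof (induction l arbitrary: x)
  case 0
  show ?case using u_mem_iff[OF W u_W] by simp
next
  case (Suc l)
  have "(C ^^ Suc l) (u x) \<in> W \<longleftrightarrow> (C ^^ l) (u (C (u x))) \<in> W"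
    unfolding Suc by (simp add: funpow_swap1)
  also have "\<dots> \<longleftrightarrow> (C ^^ Suc l) x \<in> W"
    unfolding uCu by (simp add: scale_mem_iff[OF W \<delta>_nz] funpow_swap1)
  finally show ?case .
qed

text \<open>Up to the invertible \<open>u\<^sup>2\<close> and the scalar \<alpha>, \<open>G\<close>
  acts as \<open>C\<^sup>2\<close>; hence each \<open>G\<close> counts as two applications of
  \<open>C\<close>.\<close>

lemma Cpow_G_mem_iff: "(C ^^ l) ((G ^ i) \<star> x) \<in> W \<longleftrightarrow> (C ^^ (l + 2 * i)) x \<in> W"
proof (induction i arbitrary: l)
  case 0
  show ?case by (simp add: act_1)
next
  case (Suc i)
  have "(C ^^ l) ((G ^ Suc i) \<star> x) \<in> W \<longleftrightarrow> (C ^^ l) (s \<alpha> (G \<star> (G ^ i) \<star> x)) \<in> W"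
    by (simp add: act_mult scale_mem_iff[OF W \<alpha>_nz] del: poly_module.scale_scale)
  also have "\<dots> \<longleftrightarrow> (C ^^ (l + 2)) ((G ^ i) \<star> x) \<in> W"
    unfolding uuCC[symmetric] Cpow_u_mem_iff by (simp add: funpow_swap1)
  finally show ?case unfolding Suc by simp
qed

lemma subspace_Cpow_vimage:
  shows "subspace {x. (C ^^ l) x \<in> W}" and "x \<in> {x. (C ^^ l) x \<in> W} \<Longrightarrow> u x \<in> {x. (C ^^ l) x \<in> W}"
  using W by (auto intro!: subspaceI simp: subspace_0 subspace_add subspace_scale Cpow_u_mem_iff)

lemma Cpow_act_mem: "(C ^^ l) x \<in> W \<Longrightarrow> (C ^^ l) (f \<star> x) \<in> W"
  using subspace_act[OF subspace_Cpow_vimage(1,2), of l x f] by simp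

text \<open>A polynomial prime to \<open>G\<close> acts invertibly, with a polynomial in
  \<open>u\<close> as inverse, and so can be cancelled behind \<open>C ^^ l\<close>.\<close>

lemma Cpow_act_memD:
  assumes "\<not> G dvd f" "(C ^^ l) (f \<star> x) \<in> W" shows "(C ^^ l) x \<in> W"
proof -
  obtain a where "\<And>x. (G ^ N) \<star> x = 0 \<Longrightarrow> a \<star> f \<star> x = x"
    using act_inverse[OF irreducible_G assms(1)] by blast
  then have "a \<star> f \<star> x = x" by (simp add: power_G_act)
  then show ?thesis using Cpow_act_mem[OF assms(2), of a] by simp
qed

end

lemmas Cpow_G_eq_0_iff = Cpow_G_mem_iff[of "{0}", simplified]
lemmas Cpow_act_eq_0 = Cpow_act_mem[of "{0}", simplified]

text \<open>The divisibilities in \<open>key\<close> bound the dimension of \<open>S\<close> from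
  below, the functionals \<open>fs\<close> bound it from above, and the two bounds agree.\<close>

lemma split_cyclic:
  assumes S: "subspace S" "\<And>x. x \<in> S \<Longrightarrow> u x \<in> S" "\<And>x. x \<in> S \<Longrightarrow> C x \<in> S" and nz: "\<exists>x\<in>S. x \<noteq> 0"
  obtains v n v' n' W where "1 \<le> n" "n' = n \<or> n' = n - 1" "(G ^ n) \<star> v = 0" "(G ^ n') \<star> v' = 0"
    "subspace W" "W \<subseteq> S" "\<And>x. x \<in> W \<Longrightarrow> u x \<in> W" "\<And>x. x \<in> W \<Longrightarrow> C x \<in> W"
    "dim S = dim W + degree G * n + degree G * n'"
    "S \<subseteq> span (set (chain v (degree G * n)) \<union> set (chain v' (degree G * n')) \<union> W)"
proof -
  define P where "P = (\<lambda>m. \<forall>x\<in>S. (C ^^ m) x = 0)"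
  have "P (2 * N)" unfolding P_def
    using Cpow_G_eq_0_iff[of 0 N] by (simp add: power_G_act)
  \<comment> \<open>The nilpotency index of \<open>C\<close> on \<open>S\<close>, that is, the
    largest length of a cyclic submodule.\<close>
  define m where "m = (LEAST m. P m)"
  have Pm: "(C ^^ m) x = 0" if "x \<in> S" for x
    using LeastI[of P, OF \<open>P (2 * N)\<close>] that by (auto simp: m_def P_def)
  have ge_m: "(C ^^ k) x = 0" if "m \<le> k" "x \<in> S" for k x
    using Pm[OF that(2)] funpow_add[of "k - m" m C] that(1) by simp
  have "m > 0" using nz Pm by (cases m) auto
  then have "\<not> P (m - 1)" using not_less_Least[of "m - 1" P] by (auto simp: m_def)
  then obtain v where v: "v \<in> S" "(C ^^ (m - 1)) v \<noteq> 0" by (auto simp: P_def)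
  define x0 where "x0 = (C ^^ (m - 1)) v"
  obtain \<phi> where \<phi>: "Vector_Spaces.linear s (*) \<phi>" "\<phi> x0 \<noteq> 0" using ex_functional v(2) x0_def by blast
  interpret \<phi>: Vector_Spaces.linear s "(*)" \<phi> by (rule \<phi>(1))
  \<comment> \<open>Since one \<open>G\<close> is worth two \<open>C\<close>, these are the
    exponents of the orders of \<open>v\<close> and \<open>C v\<close>.\<close>
  define n n' where "n = (m + 1) div 2" and "n' = m div 2"
  \<comment> \<open>The ring generated by \<open>u\<close> and \<open>C\<close> consists of the
    \<open>f + g C\<close> with \<open>f\<close>, \<open>g\<close> polynomials in \<open>u\<close>,
    because \<open>C\<^sup>2\<close> is such a polynomial. So these conditions define the largest
    submodule of \<open>S\<close> on which \<phi> vanishes.\<close>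
  define W where "W = {w \<in> S. \<forall>f. \<phi> (f \<star> w) = 0 \<and> \<phi> (f \<star> C w) = 0}"
  have W_sub: "subspace W"
    using S(1) unfolding W_def
    by (intro subspaceI) (auto simp: subspace_0 subspace_add subspace_scale act_add act_scale \<phi>.add \<phi>.scale)
  obtain e where e: "\<And>x. e \<star> u x = x"
    using act_inverse[OF irreducible_G not_dvd_X, of N] by (metis act_X power_G_act)
  have W_u: "u w \<in> W" if "w \<in> W" for w
  proof -
    have "C (u w) = e \<star> s \<delta> (C w)" using e[of "C (u w)"] by (simp add: uCu)
    moreover have "\<phi> (f \<star> u w) = 0" for f
      using that by (metis (mono_tags, lifting) W_def act_X act_mult mem_Collect_eq)
    moreover have "\<phi> (f \<star> e \<star> C w) = 0" for f
      using that by (metis (mono_tags, lifting) W_def act_mult mem_Collect_eq)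
    ultimately show ?thesis using that S(2) unfolding W_def
      by (simp add: act_scale \<phi>.scale del: poly_module.scale_scale)
  qed
  have W_C: "C w \<in> W" if "w \<in> W" for w
  proof -
    have "C (C w) = e \<star> e \<star> s \<alpha> (G \<star> w)" using e uuCC by metis
    moreover have "\<phi> (f \<star> e \<star> e \<star> G \<star> w) = 0" for f
      using that by (metis (mono_tags, lifting) W_def act_mult mem_Collect_eq)
    ultimately show ?thesis using that S(3) unfolding W_def
      by (simp add: act_scale \<phi>.scale del: poly_module.scale_scale)
  qed
  have x0_W: "x0 \<notin> W" using \<phi>(2) act_1[of x0] unfolding W_def by (metis (mono_tags, lifting) mem_Collect_eq)
  have kill: "(G ^ n) \<star> x = 0" "(G ^ n') \<star> C x = 0" if "x \<in> S" for x
    using Cpow_G_eq_0_iff[of 0 n x] Cpow_G_eq_0_iff[of 0 n' "C x"] ge_m[of "2 * n" x]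
      ge_m[of "Suc (2 * n')" x] that
    by (auto simp: n_def n'_def funpow_swap1)

  \<comment> \<open>At step \<open>k\<close>, \<open>C ^^ l\<close> with
    \<open>l = m - Suc k\<close> kills one of the two terms and turns the other into a polynomial
    multiple of \<open>x0\<close>. As \<open>x0\<close> is not in \<open>W\<close>, that polynomial
    must be divisible by \<open>G\<close>. Even \<open>k\<close> gains a factor of \<open>f\<close>,
    odd \<open>k\<close> a factor of \<open>g\<close>.\<close>
  have key: "G ^ ((k + 1) div 2) dvd f \<and> G ^ (k div 2) dvd g"
    if "f \<star> v + g \<star> C v \<in> W" "k \<le> m" for k f g
    using that(2)
  proof (induction k)
    case (Suc k)
    have Cl: "(C ^^ l) (f \<star> v + g \<star> C v) \<in> W" for l
      using that(1) by (induction l) (auto simp: W_C simp del: Cpow_add C_add)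
    define i where "i = k div 2"
    define l where "l = m - Suc k"
    show ?case
    proof (cases "even k")
      case True
      then have k: "k = 2 * i" by (simp add: i_def)
      then have "G ^ i dvd f" "G ^ i dvd g" using Suc by auto
      then obtain f' g' where fg: "f = G ^ i * f'" "g = G ^ i * g'" unfolding dvd_def by blast
      have li: "l + 2 * i = m - 1" using Suc.prems k by (simp add: l_def)
      have "(C ^^ (m - 1)) (C v) = 0"
        using Pm[OF v(1)] \<open>m > 0\<close> by (cases m) (auto simp: funpow_swap1)
      then have "(C ^^ l) (g \<star> C v) = 0"
        unfolding fg act_mult Cpow_G_eq_0_iff li by (rule Cpow_act_eq_0)
      then have "(C ^^ l) (f \<star> v) \<in> W" using Cl[of l] by simp
      then have "(C ^^ (m - 1)) (f' \<star> v) \<in> W"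
        using Cpow_G_mem_iff[OF W_sub W_u, where l=l and i=i and x="f' \<star> v"] unfolding fg act_mult li by simp
      then have "G dvd f'" using Cpow_act_memD[OF W_sub W_u] x0_W unfolding x0_def by blast
      then have "G ^ Suc i dvd f" unfolding fg by (simp add: mult.commute mult_dvd_mono)
      then show ?thesis using k fg by simp
    next
      case False
      then have k: "k = 2 * i + 1" by (simp add: i_def)
      then have "G ^ Suc i dvd f" "G ^ i dvd g" using Suc by auto
      then obtain f' g' where fg: "f = G ^ Suc i * f'" "g = G ^ i * g'" unfolding dvd_def by blast
      have li: "l + 2 * Suc i = m" "l + 2 * i = m - 2" using Suc.prems k by (simp_all add: l_def)
      have "(C ^^ l) (f \<star> v) = 0"
        unfolding fg act_mult Cpow_G_eq_0_iff li by (rule Cpow_act_eq_0) (rule Pm[OF v(1)])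
      then have "(C ^^ l) (g \<star> C v) \<in> W" using Cl[of l] by simp
      then have "(C ^^ (m - 2)) (g' \<star> C v) \<in> W"
        using Cpow_G_mem_iff[OF W_sub W_u, where l=l and i=i and x="g' \<star> C v"] unfolding fg act_mult li by simp
      moreover have "(C ^^ (m - 2)) (C v) = x0"
      proof -
        have "Suc (m - 2) = m - 1" using Suc.prems k by simp
        then show ?thesis unfolding x0_def by (metis comp_apply funpow_Suc_right)
      qed
      ultimately have "G dvd g'" using Cpow_act_memD[OF W_sub W_u] x0_W by metis
      then have "G ^ Suc i dvd g" unfolding fg by (simp add: mult.commute mult_dvd_mono)
      moreover have "G ^ Suc i dvd f" unfolding fg by simp
      ultimately show ?thesis using k by simp
    qed
  qed simp
  have dvd: "G ^ n dvd f \<and> G ^ n' dvd g" if "f \<star> v + g \<star> C v \<in> W" for f g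
    using key[OF that, of m] by (simp add: n_def n'_def)
  have deg: "f = 0 \<or> degree G * k \<le> degree f" if "G ^ k dvd f" for k f
    using that monic_G by (metis degree_power_eq dvd_imp_degree_le leading_coeff_0_iff mult.commute zero_neq_one)

  let ?c = "set (chain v (degree G * n))" and ?c' = "set (chain (C v) (degree G * n'))"
  have dim1: "dim (span (W \<union> ?c)) = dim W + degree G * n"
    unfolding dim_span
  proof (rule dim_Un_chain[OF W_sub])
    show "f = 0 \<or> degree G * n \<le> degree f" if "f \<star> v \<in> W" for f
      using dvd[of f 0] deg[of n f] that by (simp add: act_0_poly)
  qed
  have dim2: "dim (span (W \<union> ?c) \<union> ?c') = dim (span (W \<union> ?c)) + degree G * n'"
  proof (rule dim_Un_chain)
    fix g assume "g \<star> C v \<in> span (W \<union> ?c)"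
    then obtain w y where wy: "g \<star> C v = w + y" "w \<in> span W" "y \<in> span ?c"
      unfolding span_Un by blast
    then obtain f where "y = f \<star> v" using span_chain by blast
    then have "(- f) \<star> v + g \<star> C v = w"
      unfolding wy(1) by simp
    then have "(- f) \<star> v + g \<star> C v \<in> W" using wy(2) span_eq_iff[THEN iffD2, OF W_sub] by simp
    then show "g = 0 \<or> degree G * n' \<le> degree g" using dvd deg by blast
  qed simp

  have W_S: "W \<subseteq> S" by (auto simp: W_def)
  have upow_S: "(u ^^ i) x \<in> S" if "x \<in> S" for i x
    using that S(2) by (induction i) auto
  have sub: "span (W \<union> ?c) \<union> ?c' \<subseteq> S"
  proof -
    have "W \<union> ?c \<subseteq> S" using W_S upow_S[OF v(1)] by (auto simp: set_chain)
    moreover have "?c' \<subseteq> S" using upow_S[OF S(3)[OF v(1)]] by (auto simp: set_chain)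
    ultimately show ?thesis using span_minimal[OF _ S(1)] by blast
  qed
  have "dim S \<le> dim W + (degree G * n + degree G * n')"
  proof -
    \<comment> \<open>Because \<open>G ^ n\<close> annihilates \<open>S\<close> and
      \<open>G ^ n'\<close> annihilates its image under \<open>C\<close>, reduction modulo these
      powers leaves only finitely many of the conditions that define \<open>W\<close>.\<close>
    define fs where "fs = map (\<lambda>i w. \<phi> ((u ^^ i) w)) [0..<degree G * n] @
      map (\<lambda>i w. \<phi> ((u ^^ i) (C w))) [0..<degree G * n']"
    have "\<forall>f\<in>set fs. Vector_Spaces.linear s (*) f"
    proof
      fix f assume "f \<in> set fs"
      then obtain i where "f = (\<lambda>w. \<phi> ((u ^^ i) w)) \<or> f = (\<lambda>w. \<phi> ((u ^^ i) (C w)))"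
        by (auto simp: fs_def)
      then show "Vector_Spaces.linear s (*) f"
        by (elim disjE, simp_all)
          (unfold_locales, simp_all add: funpow_u_diff_scale \<phi>.add \<phi>.scale)+
    qed
    from dim_kernel_functionals[OF S(1) this]
    have "dim S \<le> dim {w \<in> S. \<forall>f\<in>set fs. f w = 0} + length fs" .
    also have "{w \<in> S. \<forall>f\<in>set fs. f w = 0} \<subseteq> W"
    proof
      fix w assume w: "w \<in> {w \<in> S. \<forall>f\<in>set fs. f w = 0}"
      have vanish: "\<phi> (f \<star> x) = 0" if "(G ^ k) \<star> x = 0" "\<forall>i<degree G * k. \<phi> ((u ^^ i) x) = 0" for f k x
      proof -
        have "degree (f mod G ^ k) < degree G * k \<or> f mod G ^ k = 0"
          using degree_mod_less[of "G ^ k" f] monic_G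
          by (metis degree_power_eq leading_coeff_0_iff mult.commute power_not_zero zero_neq_one)
        then have "f \<star> x = (\<Sum>i<degree G * k. s (coeff (f mod G ^ k) i) ((u ^^ i) x))"
          unfolding act_mod[OF that(1), of f, symmetric] by (rule act_less)
        then show ?thesis using that(2) by (simp add: \<phi>.sum \<phi>.scale)
      qed
      have "\<phi> (f \<star> w) = 0" for f
        by (rule vanish[of n]) (use w kill in \<open>auto simp: fs_def\<close>)
      moreover have "\<phi> (f \<star> C w) = 0" for f
        by (rule vanish[of n']) (use w kill in \<open>auto simp: fs_def\<close>)
      ultimately show "w \<in> W" using w by (simp add: W_def)
    qed
    then have "dim {w \<in> S. \<forall>f\<in>set fs. f w = 0} \<le> dim W" by (rule dim_subset)
    finally show ?thesis by (simp add: fs_def)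
  qed
  then have le: "dim S \<le> dim (span (W \<union> ?c) \<union> ?c')" using dim1 dim2 by simp
  then have eq: "dim (span (W \<union> ?c) \<union> ?c') = dim S" using dim_subset[OF sub] by simp
  have "span (span (W \<union> ?c) \<union> ?c') = S"
  proof (rule subspace_dim_equal)
    show "span (span (W \<union> ?c) \<union> ?c') \<subseteq> S" using sub S(1) by (rule span_minimal)
  qed (use S(1) le in auto)
  moreover have "span (W \<union> ?c) \<union> ?c' \<subseteq> span (?c \<union> ?c' \<union> W)"
    by (auto intro: span_base span_mono[THEN subsetD, rotated])
  then have "span (span (W \<union> ?c) \<union> ?c') \<subseteq> span (?c \<union> ?c' \<union> W)"
    by (rule span_minimal) simp
  ultimately have "S \<subseteq> span (?c \<union> ?c' \<union> W)" by simp
  moreover have "dim S = dim W + degree G * n + degree G * n'" using eq dim1 dim2 by simp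
  moreover have "1 \<le> n" "n' = n \<or> n' = n - 1" using \<open>m > 0\<close> by (auto simp: n_def n'_def)
  ultimately show ?thesis
    using that[of n n' v "C v" W] kill v(1) W_sub W_S W_u W_C by blast
qed

text \<open>Spanning and the right length are recorded in place of independence, which does not have
  to be carried through the induction; for \<open>S = UNIV\<close> they give a basis by
  \<open>is_basisI\<close>.\<close>

lemma decomposition:
  assumes "subspace S" "\<And>x. x \<in> S \<Longrightarrow> u x \<in> S" "\<And>x. x \<in> S \<Longrightarrow> C x \<in> S"
  shows "\<exists>ps. (\<forall>(v, n, v', n')\<in>set ps. 1 \<le> n \<and> (n' = n \<or> n' = n - 1)) \<and> annihilated (pair_list G ps) \<and>
    S \<subseteq> span (set (cyclic_list (pair_list G ps))) \<and> length (cyclic_list (pair_list G ps)) = dim S"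
  using assms
proof (induction "dim S" arbitrary: S rule: less_induct)
  case less
  show ?case
  proof (cases "\<exists>x\<in>S. x \<noteq> 0")
    case False
    then have "S \<subseteq> {0}" by auto
    moreover from this have "dim S = 0" by simp
    ultimately show ?thesis
      by (intro exI[of _ "[]"]) (simp add: annihilated_def cyclic_list_def pair_list_def)
  next
    case True
    from split_cyclic[OF less.prems this] obtain v n v' n' W where
      n: "1 \<le> n" "n' = n \<or> n' = n - 1" and ann: "(G ^ n) \<star> v = 0" "(G ^ n') \<star> v' = 0"
      and W: "subspace W" "\<And>x. x \<in> W \<Longrightarrow> u x \<in> W" "\<And>x. x \<in> W \<Longrightarrow> C x \<in> W"
      and dim: "dim S = dim W + degree G * n + degree G * n'"
      and span: "S \<subseteq> span (set (chain v (degree G * n)) \<union> set (chain v' (degree G * n')) \<union> W)"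
      by metis
    have "degree G > 0"
      using irreducible_G monic_G by (metis Factorial_Ring.irreducible_def bot_nat_0.not_eq_extremum is_unit_iff_degree)
    then have "dim W < dim S" using dim n(1) by simp
    from less.hyps[OF this W] obtain ps where
      ps: "\<forall>(v, n, v', n')\<in>set ps. 1 \<le> n \<and> (n' = n \<or> n' = n - 1)" "annihilated (pair_list G ps)"
      "W \<subseteq> span (set (cyclic_list (pair_list G ps)))" "length (cyclic_list (pair_list G ps)) = dim W" by blast
    have Gk: "degree (G ^ k) = degree G * k" for k
      using degree_power_eq[of G k] irreducible_G by (auto simp: Factorial_Ring.irreducible_def)
    have Gm: "lead_coeff (G ^ k) = 1" for k
      unfolding lead_coeff_power monic_G by simp
    define ps' where "ps' = (v, n, v', n') # ps"
    have cl: "cyclic_list (pair_list G ps') = chain v (degree G * n) @ chain v' (degree G * n') @ cyclic_list (pair_list G ps)"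
      by (simp add: ps'_def cyclic_list_def pair_list_def Gk)
    have "set (chain v (degree G * n)) \<union> set (chain v' (degree G * n')) \<union> W \<subseteq> span (set (cyclic_list (pair_list G ps')))"
    proof -
      have "W \<subseteq> span (set (cyclic_list (pair_list G ps')))"
        using ps(3) span_mono[of "set (cyclic_list (pair_list G ps))" "set (cyclic_list (pair_list G ps'))"] cl by auto
      then show ?thesis using span_superset[of "set (cyclic_list (pair_list G ps'))"] cl by auto
    qed
    then have "S \<subseteq> span (set (cyclic_list (pair_list G ps')))"
      using span span_minimal[OF _ subspace_span] by blast
    moreover have "annihilated (pair_list G ps')"
      using ps(2) ann Gm by (auto simp: annihilated_def ps'_def pair_list_def)
    moreover have "length (cyclic_list (pair_list G ps')) = dim S" using cl ps(4) dim by simp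
    moreover have "\<forall>(v, n, v', n')\<in>set ps'. 1 \<le> n \<and> (n' = n \<or> n' = n - 1)"
      using ps(1) n by (auto simp: ps'_def)
    ultimately show ?thesis by blast
  qed
qed

end

section \<open>Quotients and commutators\<close>

locale quadratic_quotient = fd_endomorphism s u Basis
  for s :: "'a::field \<Rightarrow> 'v::ab_group_add \<Rightarrow> 'v" and u :: "'v \<Rightarrow> 'v" and Basis :: "'v set" +
  fixes p q :: "'a poly"
  assumes p: "lead_coeff p = 1" "degree p = 2" and q: "lead_coeff q = 1" "degree q = 2"
    and irreducible_p: "Factorial_Ring.irreducible p" and irreducible_q: "Factorial_Ring.irreducible q"
    and splitting_fields: "splitting_field p \<noteq> splitting_field q"
    and traces: "(poly_tr p, poly_tr q) \<noteq> (0, 0)"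
begin

text \<open>\<alpha> and \<beta> are the norms, \<tau> and \<mu> the traces of \<open>p\<close> and
  \<open>q\<close>.\<close>

abbreviation "\<alpha> \<equiv> coeff p 0"
abbreviation "\<beta> \<equiv> coeff q 0"
abbreviation "\<tau> \<equiv> - coeff p (Suc 0)"
abbreviation "\<mu> \<equiv> - coeff q (Suc 0)"
abbreviation "\<delta> \<equiv> \<alpha> / \<beta>"
abbreviation "G \<equiv> quot_poly p q"

lemma \<alpha>_nz: "\<alpha> \<noteq> 0" and \<beta>_nz: "\<beta> \<noteq> 0"
  using irreducible_quadratic_no_root[OF irreducible_p p(2), of 0]
    irreducible_quadratic_no_root[OF irreducible_q q(2), of 0] by (auto simp: poly_0_coeff_0)

lemma \<delta>_nz: "\<delta> \<noteq> 0" and \<delta>\<beta>: "\<delta> * \<beta> = \<alpha>"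
  using \<alpha>_nz \<beta>_nz by auto

text \<open>After multiplication by \<alpha>, all coefficients are polynomials in \<alpha>,
  \<delta>, \<tau>, \<mu>; this is the form in which \<open>u\<^sup>2 C\<^sup>2\<close> comes
  out.\<close>

lemma smult_G: "smult \<alpha> G = [: \<alpha> * \<delta>\<^sup>2, - (\<tau> * \<mu> * \<delta>\<^sup>2),
    \<tau>\<^sup>2 * \<delta> + \<delta>\<^sup>2 * \<mu>\<^sup>2 - 2 * \<alpha> * \<delta>, - (\<tau> * \<mu> * \<delta>), \<alpha> :]"
  unfolding quot_poly_explicit[OF p q \<beta>_nz]
  using \<alpha>_nz \<beta>_nz by (simp add: field_simps power2_eq_square)

text \<open>The roots \<open>x/y\<close> and \<open>x'/y'\<close> have product \<delta>, and so do
  \<open>x/y'\<close> and \<open>x'/y\<close>; hence \<open>G\<close> is self-reciprocal under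
  \<open>t \<mapsto> \<delta>/t\<close>.\<close>

lemma G_reciprocal: obtains g2 g3 where "G = [: \<delta>\<^sup>2, \<delta> * g3, g2, g3, 1 :]"
proof -
  have "G = [: \<delta>\<^sup>2, \<delta> * (- (\<tau> * \<mu> / \<beta>)), \<tau>\<^sup>2 / \<beta> + \<alpha> * (\<mu> / \<beta>)\<^sup>2 - 2 * \<delta>, - (\<tau> * \<mu> / \<beta>), 1 :]"
    unfolding quot_poly_explicit[OF p q \<beta>_nz]
    using \<beta>_nz by (simp add: field_simps power2_eq_square)
  then show ?thesis by (rule that)
qed

lemma degree_G: "degree G = 4" and monic_G: "lead_coeff G = 1"
proof -
  obtain g2 g3 where G: "G = [: \<delta>\<^sup>2, \<delta> * g3, g2, g3, 1 :]" by (rule G_reciprocal)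
  show "degree G = 4" "lead_coeff G = 1" unfolding G by simp_all
qed

lemma irreducible_G: "Factorial_Ring.irreducible G"
  by (rule irreducible_quot_poly[OF p q irreducible_p irreducible_q splitting_fields traces])

lemma not_G_dvd: "f \<noteq> 0 \<Longrightarrow> degree f < 4 \<Longrightarrow> \<not> G dvd f"
  using dvd_imp_degree_le[of G f] degree_G by auto

lemma smult_G_act: "s \<alpha> (G \<star> x) = s (\<alpha> * \<delta>\<^sup>2) x - s (\<tau> * \<mu> * \<delta>\<^sup>2) (u x)
    + s (\<tau>\<^sup>2 * \<delta> + \<delta>\<^sup>2 * \<mu>\<^sup>2 - 2 * \<alpha> * \<delta>) (u (u x)) - s (\<tau> * \<mu> * \<delta>) (u (u (u x))) + s \<alpha> (u (u (u (u x))))"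
  unfolding act_smult[symmetric] smult_G
  by (simp only: act_pCons act_0_poly u_simps scale_minus_left) simp

text \<open>
  \<open>a u = \<delta> u\<^sup>-\<^sup>1 a + \<tau> u - \<delta> \<mu>\<close>, where both sides have been multiplied by \<open>u\<close>.
\<close>
definition quotient_relation :: "('v \<Rightarrow> 'v) \<Rightarrow> bool" where
  "quotient_relation a \<longleftrightarrow> (\<forall>x. u (a (u x)) = s \<delta> (a x) + s \<tau> (u (u x)) - s (\<delta> * \<mu>) (u x))"

definition twist :: "('v \<Rightarrow> 'v) \<Rightarrow> bool" where
  "twist C \<longleftrightarrow> Vector_Spaces.linear s s C \<and> (\<forall>x. u (C (u x)) = s \<delta> (C x)) \<and>
    (\<forall>x. u (u (C (C x))) = s \<alpha> (G \<star> x))"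

lemma quadratic_poly_end:
  assumes "lead_coeff f = 1" "degree f = 2"
  shows "poly_end s f a x = 0 \<longleftrightarrow> a (a x) = s (- coeff f (Suc 0)) (a x) - s (coeff f 0) x"
proof -
  have "poly_end s f a x = a (a x) - (s (- coeff f (Suc 0)) (a x) - s (coeff f 0) x)"
    using assms by (simp add: poly_end_def numeral_2_eq_2)
  then show ?thesis by simp
qed

lemma linear_simps:
  assumes "Vector_Spaces.linear s s a"
  shows "a (x + y) = a x + a y" "a (s c x) = s c (a x)" "a (x - y) = a x - a y" "a 0 = 0" "a (- x) = - a x"
proof -
  interpret a: Vector_Spaces.linear s s a by fact
  show "a (x + y) = a x + a y" "a (s c x) = s c (a x)" "a (x - y) = a x - a y" "a 0 = 0" "a (- x) = - a x"
    by (simp_all add: a.add a.scale a.diff a.neg)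
qed

lemma linearI:
  assumes "\<And>x y. a (x + y) = a x + a y" "\<And>c x. a (s c x) = s c (a x)"
  shows "Vector_Spaces.linear s s a"
  using assms by (simp add: Vector_Spaces.linear_iff vector_space_axioms)

text \<open>The terms \<open>\<tau> u - \<delta> \<mu>\<close> of the relation commute with
  \<open>u\<close> and cancel in the commutator. For the square, \<open>rel\<close> and
  \<open>pa\<close> serve as rewrite rules that bring words in \<open>u\<close> and \<open>a\<close>
  to a normal form, where all terms with \<open>a\<close> cancel.\<close>

lemma twist_commutator:
  assumes a: "Vector_Spaces.linear s s a" and pa: "\<And>x. a (a x) = s \<tau> (a x) - s \<alpha> x"
    and rel: "quotient_relation a"
  shows "twist (\<lambda>x. u (a x) - a (u x))"
proof -
  note a_simps = linear_simps[OF a]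
  have rel: "u (a (u x)) = s \<delta> (a x) + s \<tau> (u (u x)) - s (\<delta> * \<mu>) (u x)" for x
    using rel unfolding quotient_relation_def by blast
  note scale_simps = scale_right_distrib scale_right_diff_distrib scale_scale scale_minus_left scale_minus_right
  have lin: "Vector_Spaces.linear s s (\<lambda>x. u (a x) - a (u x))"
    by (rule linearI) (simp_all add: a_simps algebra_simps)
  have "u (u (a (u x)) - a (u (u x))) = s \<delta> (u (a x) - a (u x))" for x
    by (simp only: u_simps a_simps rel scale_simps) simp
  moreover have "u (u (u (a (u (a x) - a (u x))) - a (u (u (a x) - a (u x))))) = s \<alpha> (G \<star> x)" for x
  proof -
    have "u (u (u (a (u (a x) - a (u x))) - a (u (u (a x) - a (u x))))) =
      s (\<alpha> * \<delta>\<^sup>2) x - s (\<tau> * \<mu> * \<delta>\<^sup>2) (u x)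
      + s (\<tau>\<^sup>2 * \<delta> + \<delta>\<^sup>2 * \<mu>\<^sup>2 - 2 * \<alpha> * \<delta>) (u (u x)) - s (\<tau> * \<mu> * \<delta>) (u (u (u x))) + s \<alpha> (u (u (u (u x))))"
      by (simp only: u_simps a_simps rel pa scale_simps,
          simp add: scale_left_distrib scale_left_diff_distrib algebra_simps power2_eq_square,
          simp only: mult_2 add_divide_distrib scale_left_distrib)
    then show ?thesis unfolding smult_G_act .
  qed
  ultimately show ?thesis using lin unfolding twist_def by blast
qed

lemmas poly_end_p = quadratic_poly_end[OF p]
lemmas poly_end_q = quadratic_poly_end[OF q]

text \<open>The equation exhibits \<open>(b - a) / c\<close> as a two-sided inverse of
  \<open>a\<close>.\<close>

lemma bij_if_quadratic:
  assumes a: "Vector_Spaces.linear s s a" and eq: "\<And>x. a (a x) = s b (a x) - s c x" and "c \<noteq> 0"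
  shows "bij a"
proof -
  note a_simps = linear_simps[OF a]
  have "a (s (1 / c) (s b x - a x)) = x" "s (1 / c) (s b (a x) - a (a x)) = x" for x
    using \<open>c \<noteq> 0\<close> by (simp_all add: a_simps eq scale_right_diff_distrib)
  then show ?thesis by (metis bijI')
qed

lemma twist_if_quotient:
  assumes "is_quotient s p q u"
  shows "bij u" "\<exists>C. twist C"
proof -
  obtain a b where a: "automorphism s a" and b: "automorphism s b"
    and pa: "\<forall>v. poly_end s p a v = 0" and qb: "\<forall>v. poly_end s q b v = 0" and u: "u = a \<circ> inv_into UNIV b"
    using assms unfolding is_quotient_def by blast
  have lin: "Vector_Spaces.linear s s a" "Vector_Spaces.linear s s b" and bij: "bij a" "bij b"
    using a b by (auto simp: automorphism_def)
  note a_simps = linear_simps[OF lin(1)]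
  note b_simps = linear_simps[OF lin(2)]
  have pa: "a (a x) = s \<tau> (a x) - s \<alpha> x" for x using pa unfolding poly_end_p by blast
  have qb: "b (b x) = s \<mu> (b x) - s \<beta> x" for x using qb unfolding poly_end_q by blast
  show "bij u" unfolding u using bij by (simp add: bij_comp bij_imp_bij_inv)
  have ub: "u (b x) = a x" for x unfolding u using bij by (simp add: bij_is_inj)
  have ab: "a (b x) = s \<mu> (a x) - s \<beta> (u x)" for x
    using ub[of "b x"] by (simp only: qb u_simps ub)
  have "u (a (u x)) = s \<delta> (a x) + s \<tau> (u (u x)) - s (\<delta> * \<mu>) (u x)" for x
  proof -
    \<comment> \<open>The sought formula \<open>a u = \<delta> b + \<tau> u - \<delta> \<mu>\<close>
      holds after \<open>a\<close> is applied to it, by \<open>p(a) = 0\<close> and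
      \<open>\<delta> \<beta> = \<alpha>\<close>; then \<open>a\<close> is cancelled.\<close>
    have "a (s \<delta> (b x) + s \<tau> (u x) - s (\<delta> * \<mu>) x) = a (a (u x))"
      using \<delta>\<beta> by (simp add: a_simps ab pa scale_right_diff_distrib del: times_divide_eq_left)
    then have "s \<delta> (b x) + s \<tau> (u x) - s (\<delta> * \<mu>) x = a (u x)"
      using bij(1) by (meson bij_is_inj injD)
    then have "u (a (u x)) = u (s \<delta> (b x) + s \<tau> (u x) - s (\<delta> * \<mu>) x)" by simp
    then show ?thesis by (simp only: u_simps ub)
  qed
  then show "\<exists>C. twist C"
    using twist_commutator[OF lin(1) pa] unfolding quotient_relation_def by blast
qed

lemma bij_u:
  assumes "\<And>x. (G ^ N) \<star> x = 0" shows "bij u"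
proof -
  have "\<not> G dvd [:0, 1:]" by (rule not_G_dvd) simp_all
  then obtain e where e: "\<And>x. (G ^ N) \<star> x = 0 \<Longrightarrow> e \<star> [:0, 1:] \<star> x = x"
    using act_inverse[OF irreducible_G] by blast
  then have "e \<star> u x = x" "u (e \<star> x) = x" for x using assms by (simp_all add: act_X act_u)
  then show ?thesis by (metis bijI')
qed

lemma quotient_if_twist:
  assumes N: "\<And>x. (G ^ N) \<star> x = 0" and C: "twist C"
  shows "is_quotient s p q u"
proof -
  have lin_C: "Vector_Spaces.linear s s C" and uCu: "u (C (u x)) = s \<delta> (C x)"
    and uuCC: "u (u (C (C x))) = s \<alpha> (G \<star> x)" for x
    using C unfolding twist_def by blast+
  note C_simps = linear_simps[OF lin_C]
  note scale_simps = scale_right_distrib scale_right_diff_distrib scale_scale scale_minus_left scale_minus_right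
  \<comment> \<open>\<open>Q\<close> acts as
    \<open>u\<^sup>2 - \<delta> = u (u - \<delta> u\<^sup>-\<^sup>1)\<close>; the quartic
    \<open>G\<close> cannot divide it, so it is invertible.\<close>
  define Q where "Q = [:- \<delta>, 0, 1:]"
  have Q: "Q \<star> x = u (u x) - s \<delta> x" for x
    unfolding Q_def by (simp add: act_pCons act_0_poly)
  have "\<not> G dvd Q" unfolding Q_def by (rule not_G_dvd) simp_all
  then obtain e where e: "\<And>x. (G ^ N) \<star> x = 0 \<Longrightarrow> e \<star> Q \<star> x = x"
    using act_inverse[OF irreducible_G] by blast
  then have eQ: "e \<star> Q \<star> x = x" for x using N by blast
  then have Q_inj: "x = y" if "Q \<star> x = Q \<star> y" for x y using that by metis
  \<comment> \<open>This is \<open>u (C + \<tau> u - \<delta> \<mu>)\<close>, so that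
    \<open>a\<close> becomes \<open>Q\<^sup>-\<^sup>1 E\<close>.\<close>
  define E where "E = (\<lambda>x. u (C x) + s \<tau> (u (u x)) - s (\<delta> * \<mu>) (u x))"
  define a where "a = (\<lambda>x. e \<star> E x)"
  have Qa: "Q \<star> a x = E x" for x
    unfolding a_def using eQ[of "E x"] by (metis poly_module.scale_left_commute)
  have lin_E: "Vector_Spaces.linear s s E"
    by (rule linearI) (simp_all add: E_def C_simps algebra_simps)
  have lin_a: "Vector_Spaces.linear s s a"
    by (rule linearI) (simp_all add: a_def linear_simps[OF lin_E] act_add act_scale)
  note a_simps = linear_simps[OF lin_a]
  note E_simps = linear_simps[OF lin_E]
  have Q_u: "Q \<star> u x = u (Q \<star> x)" for x by (rule act_u)
  have Q_simps: "Q \<star> (x + y) = Q \<star> x + Q \<star> y" "Q \<star> (x - y) = Q \<star> x - Q \<star> y"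
    "Q \<star> s c x = s c (Q \<star> x)" for x y c
    by (simp_all add: act_scale poly_module.scale_right_distrib poly_module.scale_right_diff_distrib)
  have rel: "u (a (u x)) = s \<delta> (a x) + s \<tau> (u (u x)) - s (\<delta> * \<mu>) (u x)" for x
  proof (rule Q_inj)
    have "Q \<star> u (a (u x)) = u (E (u x))" by (simp add: Q_u Qa)
    also have "\<dots> = s \<delta> (E x) + s \<tau> (Q \<star> u (u x)) - s (\<delta> * \<mu>) (Q \<star> u x)"
      unfolding E_def by (simp add: uCu Q algebra_simps)
    finally show "Q \<star> u (a (u x)) = Q \<star> (s \<delta> (a x) + s \<tau> (u (u x)) - s (\<delta> * \<mu>) (u x))"
      by (simp only: Q_simps Qa)
  qed
  \<comment> \<open>\<open>C\<close> conjugates \<open>u - \<delta> u\<^sup>-\<^sup>1\<close> to its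
    negative; this is the sign change with inverses cleared.\<close>
  have uuCQ: "u (u (C (Q \<star> y))) = - s \<delta> (Q \<star> C y)" for y
  proof -
    have "u (u (C (u (u y)))) = s (\<delta> * \<delta>) (C y)" by (simp add: uCu)
    then show ?thesis by (simp add: Q C_simps scale_simps)
  qed
  have QCa: "Q \<star> C (a x) = s (\<delta> * \<mu>) (u (C x)) - u (C (C x)) - s (\<tau> * \<delta>) (C x)" for x
  proof -
    have "- s \<delta> (Q \<star> C (a x)) = s \<delta> (u (C (C x))) + s (\<tau> * (\<delta> * \<delta>)) (C x) - s (\<delta> * \<mu> * \<delta>) (u (C x))"
      unfolding uuCQ[symmetric] Qa unfolding E_def by (simp only: C_simps u_simps uCu scale_simps) (simp add: mult_ac)
    also have "\<dots> = - s \<delta> (s (\<delta> * \<mu>) (u (C x)) - u (C (C x)) - s (\<tau> * \<delta>) (C x))"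
      by (simp only: scale_simps) (simp add: mult_ac)
    finally show ?thesis unfolding neg_equal_iff_equal by (rule scale_left_imp_eq[OF \<delta>_nz])
  qed
  \<comment> \<open>Each \<open>a\<close> hides one inverse of \<open>Q\<close>, so the quadratic
    identity is checked after two applications of the injective \<open>Q\<close>.\<close>
  have pa: "a (a x) = s \<tau> (a x) - s \<alpha> x" for x
  proof (rule Q_inj, rule Q_inj)
    have "Q \<star> Q \<star> a (a x) = u (Q \<star> C (a x)) + s \<tau> (u (u (E x))) - s (\<delta> * \<mu>) (u (E x))"
      unfolding Qa unfolding fun_cong[OF E_def, of "a x"] by (simp only: Q_simps Q_u Qa)
    also have "\<dots> = s \<tau> (Q \<star> E x) - s \<alpha> (Q \<star> Q \<star> x)"
      unfolding QCa unfolding E_def Q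
      by (simp only: u_simps uuCC smult_G_act scale_simps,
          simp add: scale_left_distrib scale_left_diff_distrib algebra_simps power2_eq_square,
          simp only: mult_2 add_divide_distrib scale_left_distrib)
    finally show "Q \<star> Q \<star> a (a x) = Q \<star> Q \<star> (s \<tau> (a x) - s \<alpha> x)"
      by (simp only: Q_simps Qa)
  qed
  have bij_u: "bij u" by (rule bij_u) (rule N)
  define w where "w = inv_into UNIV u"
  have uw: "u (w x) = x" and wu: "w (u x) = x" for x
    using bij_u by (simp_all add: w_def bij_is_surj bij_is_inj surj_f_inv_f)
  have lin_w: "Vector_Spaces.linear s s w"
    by (rule linearI) (metis uw wu u_add, metis uw wu u_scale)
  define b where "b = (\<lambda>x. w (a x))"
  have lin_b: "Vector_Spaces.linear s s b"
    by (rule linearI) (simp_all add: b_def a_simps linear_simps[OF lin_w])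
  have bij_a: "bij a" by (rule bij_if_quadratic[OF lin_a pa \<alpha>_nz])
  \<comment> \<open>Applying \<open>a\<close> to the relation and comparing with
    \<open>p(a) = 0\<close> gives \<open>q(b) = 0\<close> multiplied by \<open>u\<close>, since
    \<open>u b = a\<close>.\<close>
  have awa: "a (b x) = s \<mu> (a x) - s \<beta> (u x)" for x
  proof -
    have "a (u x) = s \<delta> (b x) + s \<tau> (u x) - s (\<delta> * \<mu>) x"
      using arg_cong[OF rel[of x], of w] by (simp add: wu b_def linear_simps[OF lin_w])
    then have "a (a (u x)) = a (s \<delta> (b x) + s \<tau> (u x) - s (\<delta> * \<mu>) x)" by simp
    then have "s \<tau> (a (u x)) - s \<alpha> (u x) = s \<delta> (a (b x)) + s \<tau> (a (u x)) - s (\<delta> * \<mu>) (a x)"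
      by (simp only: pa a_simps)
    moreover have "d = m - c" if "t - c = d + t - m" for t c d m :: 'v
      using that by (simp add: algebra_simps)
    ultimately have "s \<delta> (a (b x)) = s (\<delta> * \<mu>) (a x) - s (\<delta> * \<beta>) (u x)"
      unfolding \<delta>\<beta> by blast
    also have "\<dots> = s \<delta> (s \<mu> (a x) - s \<beta> (u x))"
      by (simp only: scale_right_diff_distrib scale_scale)
    finally show ?thesis by (rule scale_left_imp_eq[OF \<delta>_nz])
  qed
  have qb: "b (b x) = s \<mu> (b x) - s \<beta> x" for x
  proof -
    have "b (b x) = w (s \<mu> (a x) - s \<beta> (u x))" by (simp only: fun_cong[OF b_def, of "b x"] awa)
    then show ?thesis by (simp add: b_def wu linear_simps[OF lin_w])
  qed
  have "bij b" by (rule bij_if_quadratic[OF lin_b qb \<beta>_nz])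
  moreover have "u = a \<circ> inv_into UNIV b"
  proof
    fix x
    have "u (b (inv_into UNIV b x)) = a (inv_into UNIV b x)" by (simp add: b_def uw)
    then show "u x = (a \<circ> inv_into UNIV b) x" using \<open>bij b\<close> by (simp add: bij_is_surj surj_f_inv_f)
  qed
  ultimately show ?thesis
    unfolding is_quotient_def automorphism_def poly_end_p poly_end_q
    using lin_a lin_b bij_a pa qb by blast
qed

lemma decomposition_if_twist:
  assumes N: "\<And>x. (G ^ N) \<star> x = 0" and C: "twist C"
  shows "\<exists>ps. (\<forall>(v, n, v', n')\<in>set ps. 1 \<le> n \<and> (n' = n \<or> n' = n - 1)) \<and> annihilated (pair_list G ps) \<and>
    UNIV \<subseteq> span (set (cyclic_list (pair_list G ps))) \<and> length (cyclic_list (pair_list G ps)) = dim UNIV"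
proof -
  interpret twisted_endomorphism s u Basis C \<delta> \<alpha> G N
  proof unfold_locales
    show "\<not> G dvd [:0, 1:]" by (rule not_G_dvd) simp_all
  qed (use C linear_simps(1,2)[of C] \<delta>_nz \<alpha>_nz irreducible_G monic_G N in \<open>auto simp: twist_def\<close>)
  show ?thesis by (rule decomposition) simp_all
qed

end

section \<open>Bases as lists, and the orders of their cyclic generators\<close>

context finite_dimensional_vector_space begin

lemma is_basisI:
  assumes "UNIV \<subseteq> span (set bs)" "length bs = dim UNIV"
  shows "is_basis scale bs"
proof -
  have c: "card (set bs) \<le> dim UNIV" using assms(2) card_length[of bs] by simp
  have "independent (set bs)" using assms(1) c by (intro card_le_dim_spanning[of _ UNIV]) auto
  moreover have "dim UNIV \<le> card (set bs)" using assms(1) by (rule dim_le_card) simp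
  then have "distinct bs" using assms(2) c by (intro card_distinct) simp
  ultimately show ?thesis using assms(1) unfolding is_basis_def by auto
qed

lemma linear_on_basis:
  assumes "is_basis scale bs" "length ys = length bs"
  shows "\<exists>f. Vector_Spaces.linear scale scale f \<and> map f bs = ys"
proof -
  interpret vector_space_pair scale scale ..
  have d: "distinct bs" "independent (set bs)" using assms(1) by (auto simp: is_basis_def)
  obtain f where f: "Vector_Spaces.linear scale scale f"
    "\<And>x. x \<in> set bs \<Longrightarrow> f x = the (map_of (zip bs ys) x)"
    using linear_independent_extend[OF d(2), of "\<lambda>x. the (map_of (zip bs ys) x)"] by blast
  have "map f bs = ys"
  proof (rule nth_equalityI)
    fix i assume "i < length (map f bs)"
    then show "map f bs ! i = ys ! i"
      using f(2)[of "bs ! i"] map_of_zip_nth[OF assms(2)[symmetric] d(1), of i] assms(2) by simp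
  qed (simp add: assms(2))
  with f(1) show ?thesis by blast
qed

end

text \<open>Recovers the values of a linear map on one block from its prescription on the whole
  basis.\<close>

lemma map_concat_eqD:
  assumes "map h (concat (map f xs)) = concat (map g xs)" "\<And>x. length (f x) = length (g x)" "x \<in> set xs"
  shows "map h (f x) = g x"
  using assms(1,3) by (induction xs) (auto simp: assms(2))

context endomorphism begin

lemma act_funpow: "f \<star> (u ^^ i) v = (u ^^ i) (f \<star> v)"
  by (induction i) (simp_all add: act_u)

lemma cyclic_list_annihilator:
  assumes ann: "annihilated xs" and span: "UNIV \<subseteq> span (set (cyclic_list xs))"
    and dvd: "\<And>v r. (v, r) \<in> set xs \<Longrightarrow> r dvd f"
  shows "f \<star> x = 0"
proof -
  have "subspace {x. f \<star> x = 0}"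
    by (intro subspaceI) (auto simp: act_add act_scale)
  moreover have "set (cyclic_list xs) \<subseteq> {x. f \<star> x = 0}"
  proof
    fix x assume "x \<in> set (cyclic_list xs)"
    then obtain v r i where vr: "(v, r) \<in> set xs" "x = (u ^^ i) v"
      by (auto simp: cyclic_list_def set_chain)
    obtain g where "f = g * r" using dvd[OF vr(1)] by (metis dvd_def mult.commute)
    moreover have "r \<star> v = 0" using ann vr(1) by (auto simp: annihilated_def)
    ultimately have "f \<star> v = 0" by (simp add: act_mult)
    moreover have "(u ^^ i) 0 = 0" by (induction i) simp_all
    ultimately show "x \<in> {x. f \<star> x = 0}" by (simp add: vr(2) act_funpow)
  qed
  ultimately have "span (set (cyclic_list xs)) \<subseteq> {x. f \<star> x = 0}" by (rule span_minimal[rotated])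
  then show ?thesis using span by blast
qed

text \<open>The remainder of \<open>f\<close> modulo \<open>r\<close> has degree below the length of
  the chain of \<open>v\<close>; that chain is independent as part of a basis, so the remainder
  vanishes.\<close>

lemma cyclic_list_dvd:
  assumes basis: "is_basis s (cyclic_list xs)" and ann: "annihilated xs"
    and vr: "(v, r) \<in> set xs" and f: "f \<star> v = 0"
  shows "r dvd f"
proof -
  have r: "lead_coeff r = 1" "r \<star> v = 0" using ann vr by (auto simp: annihilated_def)
  obtain ys zs where xs: "xs = ys @ (v, r) # zs" using vr by (meson split_list)
  let ?c = "chain v (degree r)"
  have "distinct ?c" "set ?c \<subseteq> set (cyclic_list xs)"
    using basis unfolding is_basis_def xs cyclic_list_def by auto
  then have "independent (set ?c)" and d: "inj_on (\<lambda>i. (u ^^ i) v) {..<degree r}"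
    using basis independent_mono[of "set (cyclic_list xs)" "set ?c"]
    by (simp_all add: is_basis_def chain_def distinct_map atLeast0LessThan)
  have "r \<noteq> 0" using r by auto
  define g where "g = f mod r"
  have g: "degree g < degree r \<or> g = 0" using degree_mod_less[OF \<open>r \<noteq> 0\<close>, of f] by (auto simp: g_def)
  have "(\<Sum>i<degree r. s (coeff g i) ((u ^^ i) v)) = 0"
    using act_less[OF g, of v] act_mod[OF r(2), of f] f by (simp add: g_def)
  also have "(\<Sum>i<degree r. s (coeff g i) ((u ^^ i) v)) =
      (\<Sum>x\<in>set ?c. s (coeff g (the_inv_into {..<degree r} (\<lambda>i. (u ^^ i) v) x)) x)"
    unfolding set_chain sum.reindex[OF d] by (rule sum.cong) (simp_all add: the_inv_into_f_f[OF d])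
  finally have sum0: "(\<Sum>x\<in>set ?c. s (coeff g (the_inv_into {..<degree r} (\<lambda>i. (u ^^ i) v) x)) x) = 0" .
  have "coeff g i = 0" if "i < degree r" for i
  proof -
    have "(u ^^ i) v \<in> set ?c" using that by (auto simp: set_chain)
    from independentD[OF \<open>independent (set ?c)\<close> _ subset_refl sum0 this]
    have "coeff g (the_inv_into {..<degree r} (\<lambda>i. (u ^^ i) v) ((u ^^ i) v)) = 0" by simp
    then show ?thesis using that by (simp add: the_inv_into_f_f[OF d])
  qed
  then have "g = 0" using g by (metis leading_coeff_0_iff)
  then show ?thesis by (simp add: g_def mod_eq_0_iff_dvd)
qed

end

section \<open>The operator \<open>C\<close> on a given block decomposition\<close>

context quadratic_quotient begin

definition u_inv :: "'v \<Rightarrow> 'v" where "u_inv = inv_into UNIV u"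

text \<open>The operator to which \<open>C\<close> has to conjugate \<open>u\<close>, that is,
  \<open>C u = conj_u C\<close>.\<close>

definition conj_u :: "'v \<Rightarrow> 'v" where "conj_u x = s \<delta> (u_inv x)"

abbreviation conj_act :: "'a poly \<Rightarrow> 'v \<Rightarrow> 'v" where "conj_act f x \<equiv> poly_end s f conj_u x"

context
  assumes bij_u: "bij u"
begin

lemma u_inv_simps [simp]: "u (u_inv x) = x" "u_inv (u x) = x"
  using bij_u by (simp_all add: u_inv_def bij_is_surj bij_is_inj surj_f_inv_f)

lemma u_eq_iff: "u x = u y \<longleftrightarrow> x = y"
  using bij_u by (simp add: bij_is_inj inj_eq)

lemma u_eq_0_iff: "u x = 0 \<longleftrightarrow> x = 0"
  using u_eq_iff[of x 0] by simp

lemma linear_u_inv: "Vector_Spaces.linear s s u_inv"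
  by (rule linearI) (metis u_inv_simps u_add, metis u_inv_simps u_scale)

lemma linear_conj_u: "Vector_Spaces.linear s s conj_u"
  by (rule linearI) (simp_all add: conj_u_def linear_simps[OF linear_u_inv] scale_right_distrib mult.commute)

lemma u_conj_u: "u (conj_u x) = s \<delta> x" "conj_u (u x) = s \<delta> x"
  by (simp_all add: conj_u_def)

interpretation U: endomorphism s conj_u
  by unfold_locales (simp_all add: linear_simps[OF linear_conj_u])

text \<open>Self-reciprocity of \<open>G\<close>, evaluated at \<open>u\<close>. It transports
  annihilation by powers of \<open>G\<close> from \<open>u\<close> to \<open>conj_u\<close>.\<close>

lemma conj_act_G: "u (u (u (u (conj_act G x)))) = s (\<delta>\<^sup>2) (G \<star> x)"
proof -
  obtain g2 g3 where G: "G = [: \<delta>\<^sup>2, \<delta> * g3, g2, g3, 1 :]" by (rule G_reciprocal)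
  show ?thesis
    unfolding G by (simp only: act_pCons U.act_pCons act_0_poly U.act_0_poly u_simps U.u_simps u_conj_u
        scale_right_distrib scale_scale scale_zero_right add_0_right scale_one)
      (simp add: power2_eq_square ac_simps)
qed

lemma conj_act_power_G:
  assumes "(G ^ k) \<star> x = 0" shows "conj_act (G ^ k) x = 0"
proof -
  define T where "T = (\<lambda>x. u (u (u (u x))))"
  have T: "(T ^^ k) (s c x) = s c ((T ^^ k) x)" "(T ^^ k) (f \<star> x) = f \<star> (T ^^ k) x" for k c x f
    by (induction k) (simp_all add: T_def act_u)
  have "(T ^^ k) (conj_act (G ^ k) x) = s ((\<delta>\<^sup>2) ^ k) ((G ^ k) \<star> x)" for x
  proof (induction k arbitrary: x)
    case 0
    show ?case by (simp add: act_1 U.act_1)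
  next
    case (Suc k)
    have "(T ^^ Suc k) (conj_act (G ^ Suc k) x) = (T ^^ k) (T (conj_act G (conj_act (G ^ k) x)))"
      by (simp add: U.act_mult funpow_swap1 del: U.poly_module.scale_scale)
    also have "\<dots> = s (\<delta>\<^sup>2) (G \<star> (T ^^ k) (conj_act (G ^ k) x))"
      unfolding T_def conj_act_G by (simp add: T[unfolded T_def])
    also have "\<dots> = s ((\<delta>\<^sup>2) ^ Suc k) ((G ^ Suc k) \<star> x)"
      unfolding Suc by (simp add: act_scale mult.commute)
    finally show ?case .
  qed
  then have "(T ^^ k) (conj_act (G ^ k) x) = 0" by (simp add: assms)
  moreover have "(T ^^ k) y = 0 \<Longrightarrow> y = 0" for y
    by (induction k) (auto simp: T_def u_eq_0_iff)
  ultimately show ?thesis by blast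
qed

text \<open>On each block, \<open>C v = v'\<close> and \<open>C v' = z v\<close>, where
  \<open>z v\<close> is forced by \<open>u\<^sup>2 C\<^sup>2 v = \<alpha> G v\<close>. The rest is
  dictated by \<open>C f(u) = f(conj_u) C\<close>, so chains of \<open>u\<close> are mapped to
  chains of \<open>conj_u\<close>.\<close>

lemma twist_if_decomposition:
  assumes ps: "\<forall>(v, n, v', n')\<in>set ps. 1 \<le> n \<and> (n' = n \<or> n' = n - 1)"
    and ann: "annihilated (pair_list G ps)" and basis: "is_basis s (cyclic_list (pair_list G ps))"
  shows "\<exists>C. twist C"
proof -
  define z where "z = (\<lambda>v. s \<alpha> (u_inv (u_inv (G \<star> v))))"
  have uuz: "u (u (z v)) = s \<alpha> (G \<star> v)" for v by (simp add: z_def)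
  define src where "src = (\<lambda>(v, n, v', n'). chain v (4 * n) @ chain v' (4 * n'))"
  define img where "img = (\<lambda>(v, n::nat, v', n'::nat). U.chain v' (4 * n) @ U.chain (z v) (4 * n'))"
  have deg: "degree (G ^ k) = 4 * k" for k
    using degree_power_eq[of G k] degree_G by (metis degree_0 mult.commute zero_neq_numeral)
  have src: "cyclic_list (pair_list G ps) = concat (map src ps)"
    unfolding cyclic_list_def pair_list_def src_def
    by (induction ps) (auto simp: deg)
  have len: "length (src x) = length (img x)" for x by (cases x) (simp add: src_def img_def)
  have "length (concat (map img ps)) = length (concat (map src ps))"
    by (simp add: length_concat comp_def len)
  from linear_on_basis[OF basis[unfolded src] this] obtain C where
    lin_C: "Vector_Spaces.linear s s C" and C: "map C (concat (map src ps)) = concat (map img ps)" by blast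
  interpret C: Vector_Spaces.linear s s C by (rule lin_C)
  \<comment> \<open>The map is prescribed only on powers of \<open>u\<close> below the order.
    Reduction of \<open>f\<close> modulo \<open>G ^ k\<close>, which annihilates \<open>a\<close>
    under \<open>u\<close> and \<open>b\<close> under \<open>conj_u\<close>, extends the formula to
    all \<open>f\<close>.\<close>
  have C_chain: "C (f \<star> a) = conj_act f b"
    if eq: "\<And>i. i < 4 * k \<Longrightarrow> C ((u ^^ i) a) = (conj_u ^^ i) b" and a: "(G ^ k) \<star> a = 0"
      and b: "(G ^ k) \<star> b = 0" for a b k f
  proof -
    define g where "g = f mod (G ^ k)"
    have "G ^ k \<noteq> 0" using irreducible_G by auto
    then have g: "degree g < 4 * k \<or> g = 0" unfolding g_def deg[symmetric] using degree_mod_less by blast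
    have "C (f \<star> a) = C (g \<star> a)" by (simp add: g_def act_mod[OF a])
    also have "\<dots> = (\<Sum>i<4 * k. s (coeff g i) ((conj_u ^^ i) b))"
      by (simp add: act_less[OF g] C.sum C.scale eq)
    also have "\<dots> = conj_act g b" by (rule U.act_less[OF g, symmetric])
    also have "\<dots> = conj_act f b"
      unfolding g_def by (rule U.act_mod[OF conj_act_power_G[OF b]])
    finally show ?thesis .
  qed
  have C1: "C (f \<star> v) = conj_act f v'" and C2: "C (f \<star> v') = conj_act f (z v)"
    if "(v, n, v', n') \<in> set ps" for f v n v' n'
  proof -
    have "map C (src (v, n, v', n')) = img (v, n, v', n')"
      using map_concat_eqD[OF C len that] .
    then have "map C (chain v (4 * n)) = U.chain v' (4 * n)" "map C (chain v' (4 * n')) = U.chain (z v) (4 * n')"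
      by (auto simp: src_def img_def)
    then have eq: "i < 4 * n \<Longrightarrow> C ((u ^^ i) v) = (conj_u ^^ i) v'"
      "i < 4 * n' \<Longrightarrow> C ((u ^^ i) v') = (conj_u ^^ i) (z v)" for i
      by (auto simp: chain_def U.chain_def)
    \<comment> \<open>The shape of the blocks makes \<open>C\<close> consistent:
      \<open>n' \<le> n\<close> is needed for \<open>G ^ n\<close> to annihilate \<open>v'\<close>,
      and \<open>n \<le> Suc n'\<close> for \<open>G ^ n'\<close> to annihilate
      \<open>z v\<close>.\<close>
    have n: "1 \<le> n" "n' \<le> n" "n \<le> Suc n'" using ps that by auto
    have "(v, G ^ n) \<in> set (pair_list G ps)" "(v', G ^ n') \<in> set (pair_list G ps)"
      using that by (force simp: pair_list_def)+
    then have kill: "(G ^ n) \<star> v = 0" "(G ^ n') \<star> v' = 0" using ann by (auto simp: annihilated_def)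
    have up: "(G ^ l) \<star> x = 0" if "(G ^ k) \<star> x = 0" "k \<le> l" for k l x
    proof -
      have "G ^ l = G ^ (l - k) * G ^ k" using that(2) by (simp add: power_add[symmetric])
      then show ?thesis using that(1) by (simp add: act_mult)
    qed
    show "C (f \<star> v) = conj_act f v'"
      by (rule C_chain[of n, OF eq(1) kill(1) up[OF kill(2) n(2)]])
    have "u (u ((G ^ n') \<star> z v)) = s \<alpha> ((G ^ Suc n') \<star> v)"
      unfolding act_u[symmetric] uuz by (simp add: act_scale mult.commute)
    also have "\<dots> = 0" using up[OF kill(1) n(3)] by (simp del: power_Suc)
    finally have z: "(G ^ n') \<star> z v = 0" by (simp add: u_eq_0_iff)
    show "C (f \<star> v') = conj_act f (z v)" by (rule C_chain[of n', OF eq(2) kill(2) z])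
  qed
  \<comment> \<open>The polynomial multiples of the generators include the basis, so linear
    identities need only be checked there.\<close>
  have all: "P x" if sub: "subspace {x. P x}"
    and gen: "\<And>v n v' n' f. (v, n, v', n') \<in> set ps \<Longrightarrow> P (f \<star> v) \<and> P (f \<star> v')" for P x
  proof -
    have "set (concat (map src ps)) \<subseteq> {x. P x}"
    proof
      fix y assume "y \<in> set (concat (map src ps))"
      then obtain x where "x \<in> set ps" "y \<in> set (src x)" by auto
      moreover obtain v n v' n' where x: "x = (v, n, v', n')" by (cases x)
      ultimately have "(v, n, v', n') \<in> set ps"
        "y \<in> (\<lambda>i. (u ^^ i) v) ` {..<4 * n} \<union> (\<lambda>i. (u ^^ i) v') ` {..<4 * n'}"
        by (simp_all add: src_def set_chain)
      then obtain i where "(v, n, v', n') \<in> set ps" "y = (u ^^ i) v \<or> y = (u ^^ i) v'" by blast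
      then show "y \<in> {x. P x}"
        using gen[of v n v' n' "monom 1 i"] by (auto simp: act_monom)
    qed
    then have "span (set (concat (map src ps))) \<subseteq> {x. P x}" using sub by (rule span_minimal)
    then show ?thesis using basis unfolding src is_basis_def by blast
  qed
  have Cu: "C (u x) = conj_u (C x)" for x
  proof (rule all[where P="\<lambda>x. C (u x) = conj_u (C x)"])
    show "subspace {x. C (u x) = conj_u (C x)}"
      by (intro subspaceI) (auto simp: C.add C.scale)
    fix v n v' n' f assume m: "(v, n, v', n') \<in> set ps"
    have "u (f \<star> v) = (pCons 0 f) \<star> v" "u (f \<star> v') = (pCons 0 f) \<star> v'" by (simp_all add: act_pCons)
    then show "C (u (f \<star> v)) = conj_u (C (f \<star> v)) \<and> C (u (f \<star> v')) = conj_u (C (f \<star> v'))"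
      by (simp only: C1[OF m] C2[OF m] U.act_pCons) simp
  qed
  have "C (conj_u x) = u (C x)" for x
  proof -
    have "C (conj_u (u (u_inv x))) = u (C (u (u_inv x)))"
      unfolding u_conj_u Cu by (simp add: C.scale u_conj_u)
    then show ?thesis by simp
  qed
  then have Cconj: "C (conj_act f x) = f \<star> C x" for f x
    by (rule U.act_intertwine[OF lin_C])
  have "u (C (u x)) = s \<delta> (C x)" for x by (simp add: Cu u_conj_u)
  moreover have "u (u (C (C x))) = s \<alpha> (G \<star> x)" for x
  proof (rule all[where P="\<lambda>x. u (u (C (C x))) = s \<alpha> (G \<star> x)"])
    show "subspace {x. u (u (C (C x))) = s \<alpha> (G \<star> x)}"
      by (intro subspaceI) (auto simp: C.add C.scale act_add act_scale scale_right_distrib mult.commute)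
    fix v n v' n' f assume m: "(v, n, v', n') \<in> set ps"
    have Cv': "C v' = z v" using C2[OF m, of 1] by (simp add: act_1 U.act_1)
    have Cv: "C v = v'" using C1[OF m, of 1] by (simp add: act_1 U.act_1)
    have "u (u (C (C (f \<star> v)))) = f \<star> u (u (z v))"
      by (simp add: C1[OF m] Cconj Cv' act_u)
    also have "\<dots> = s \<alpha> (G \<star> f \<star> v)" unfolding uuz
      by (simp add: act_scale mult.commute)
    finally have 1: "u (u (C (C (f \<star> v)))) = s \<alpha> (G \<star> f \<star> v)" .
    \<comment> \<open>On \<open>v'\<close> the square of \<open>C\<close> is not prescribed: it is
      \<open>C (z v)\<close>, and self-reciprocity turns the resulting \<open>G(conj_u)\<close> back
      into \<open>G(u)\<close>.\<close>
    have "conj_u (conj_u (C (z v))) = C (u (u (z v)))" by (simp add: Cu)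
    also have "\<dots> = s \<alpha> (conj_act G v')" unfolding uuz by (simp add: C.scale C1[OF m])
    finally have "u (u (u (u (conj_u (conj_u (C (z v))))))) = s \<alpha> (s (\<delta>\<^sup>2) (G \<star> v'))"
      using conj_act_G[of v'] by simp
    then have "s (\<delta>\<^sup>2) (u (u (C (z v)))) = s (\<delta>\<^sup>2) (s \<alpha> (G \<star> v'))"
      by (simp add: u_conj_u power2_eq_square mult.commute)
    then have Cz: "u (u (C (z v))) = s \<alpha> (G \<star> v')"
      by (rule scale_left_imp_eq[rotated]) (simp add: \<alpha>_nz \<beta>_nz)
    have "u (u (C (C (f \<star> v')))) = f \<star> u (u (C (z v)))"
      by (simp add: C2[OF m] Cconj act_u)
    also have "\<dots> = s \<alpha> (G \<star> f \<star> v')" unfolding Cz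
      by (simp add: act_scale mult.commute)
    finally show "u (u (C (C (f \<star> v)))) = s \<alpha> (G \<star> f \<star> v) \<and>
        u (u (C (C (f \<star> v')))) = s \<alpha> (G \<star> f \<star> v')"
      using 1 by blast
  qed
  ultimately show ?thesis using lin_C unfolding twist_def by blast
qed

end

end

section \<open>Eigenvalues in the algebraic closure\<close>

lemma map_poly_to_ac_mult: "map_poly to_ac (f * g) = map_poly to_ac f * map_poly to_ac g"
  by (rule poly_eqI) (simp add: coeff_map_poly coeff_mult to_ac_sum)

lemma map_poly_to_ac_add: "map_poly to_ac (f + g) = map_poly to_ac f + map_poly to_ac g"
  by (rule poly_eqI) (simp add: coeff_map_poly)

lemma Root_mult: "Root (f * g) = Root f \<union> Root g"
  by (auto simp: Root_def map_poly_to_ac_mult)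

lemma Root_power: "Root (f ^ n) \<subseteq> Root f"
  by (induction n) (auto simp: Root_mult, simp add: Root_def)

text \<open>Polynomials prime to each other have no common root, by Bezout; so \<open>g\<close>
  divides \<open>f\<close> as long as \<open>f\<close> is not constant, and cancelling it lowers the
  degree.\<close>

lemma dvd_power_if_Root_subset:
  fixes f g :: "'a::field poly"
  assumes g: "Factorial_Ring.irreducible g" and "f \<noteq> 0" "Root f \<subseteq> Root g"
  shows "\<exists>n. f dvd g ^ n"
  using assms(2,3)
proof (induction "degree f" arbitrary: f rule: less_induct)
  case less
  show ?case
  proof (cases "degree f = 0")
    case True
    then have "f dvd g ^ 0" using less.prems by (simp add: is_unit_iff_degree)
    then show ?thesis by blast
  next
    case False
    then obtain c where c: "c \<in> Root f" using Root_nonempty[of f] by blast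
    have "g dvd f"
    proof (rule ccontr)
      assume "\<not> g dvd f"
      then obtain a b where "a * f + b * g = 1" using irreducible_poly_bezout[OF g] by blast
      then have "poly (map_poly to_ac (a * f + b * g)) c = 1" by simp
      then show False using c less.prems(2)
        by (auto simp: Root_def map_poly_to_ac_add map_poly_to_ac_mult)
    qed
    then obtain h where h: "f = g * h" unfolding dvd_def by blast
    have dg: "degree g > 0"
      using g by (metis Factorial_Ring.irreducible_def bot_nat_0.not_eq_extremum is_unit_iff_degree)
    have "h \<noteq> 0" using h less.prems(1) by auto
    then have "degree h < degree f" using h dg by (subst h, subst degree_mult_eq) auto
    moreover have "Root h \<subseteq> Root g" using less.prems(2) by (auto simp: h Root_mult)
    ultimately obtain n where "h dvd g ^ n" using less.hyps \<open>h \<noteq> 0\<close> by blast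
    then have "f dvd g ^ Suc n" by (simp add: h mult_dvd_mono)
    then show ?thesis by blast
  qed
qed

context fd_endomorphism begin

lemma represents_exists: "\<exists>bs M. represents s u bs M"
proof -
  obtain bs where bs: "set bs = Basis" "distinct bs"
    using finite_distinct_list[OF finite_Basis] by blast
  have basis: "is_basis s bs"
    using bs independent_Basis span_Basis by (simp add: is_basis_def)
  define M where "M = mat (length bs) (length bs) (\<lambda>(i, j). representation Basis (u (bs ! j)) (bs ! i))"
  have "u (bs ! j) = (\<Sum>i<length bs. s (M $$ (i, j)) (bs ! i))" if j: "j < length bs" for j
  proof -
    have "u (bs ! j) = (\<Sum>b\<in>Basis. s (representation Basis (u (bs ! j)) b) b)"
      by (rule sum_representation_eq[symmetric])
        (simp_all add: independent_Basis span_Basis finite_Basis)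
    also have "\<dots> = (\<Sum>i<length bs. s (representation Basis (u (bs ! j)) (bs ! i)) (bs ! i))"
      using bs by (intro sum.reindex_bij_betw[symmetric] bij_betwI') (auto simp: nth_eq_iff_index_eq in_set_conv_nth)
    also have "\<dots> = (\<Sum>i<length bs. s (M $$ (i, j)) (bs ! i))"
      using j by (intro sum.cong) (simp_all add: M_def)
    finally show ?thesis .
  qed
  then have "represents s u bs M" using basis by (simp add: represents_def M_def)
  then show ?thesis by blast
qed

text \<open>Cayley-Hamilton by the adjugate: with its entries acting as polynomials in
  \<open>u\<close>, every column of the characteristic matrix sends the basis to zero, and
  multiplication by the adjugate leaves \<open>char_poly M\<close> on each basis vector.\<close>

lemma char_poly_act:
  assumes rep: "represents s u bs M"
  shows "char_poly M \<star> x = 0"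
proof -
  let ?n = "length bs"
  have M: "M \<in> carrier_mat ?n ?n" and u: "\<And>j. j < ?n \<Longrightarrow> u (bs ! j) = (\<Sum>i<?n. s (M $$ (i, j)) (bs ! i))"
    and basis: "is_basis s bs" using rep by (auto simp: represents_def)
  define A where "A = char_poly_matrix M"
  have A: "A \<in> carrier_mat ?n ?n" unfolding A_def using M by simp
  have A_ij: "A $$ (i, j) = (if i = j then [:0, 1:] else 0) + [:- (M $$ (i, j)):]"
    if "i < ?n" "j < ?n" for i j
    using that M by (auto simp: A_def char_poly_matrix_def)
  have col: "(\<Sum>i<?n. (A $$ (i, j)) \<star> bs ! i) = 0" if j: "j < ?n" for j
  proof -
    have "(\<Sum>i<?n. (A $$ (i, j)) \<star> bs ! i) = (\<Sum>i<?n. (if i = j then u (bs ! i) else 0) - s (M $$ (i, j)) (bs ! i))"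
      using j by (intro sum.cong) (auto simp: A_ij act_add_poly act_pCons)
    also have "\<dots> = 0" using j by (simp add: sum_subtractf u)
    finally show ?thesis .
  qed
  have kill: "char_poly M \<star> bs ! k = 0" if k: "k < ?n" for k
  proof -
    let ?B = "adj_mat A"
    have B: "?B \<in> carrier_mat ?n ?n" using adj_mat(1)[OF A] .
    have AB: "(\<Sum>j<?n. ?B $$ (j, k) * A $$ (i, j)) = (if i = k then char_poly M else 0)" if "i < ?n" for i
    proof -
      have "(A * ?B) $$ (i, k) = (\<Sum>j<?n. A $$ (i, j) * ?B $$ (j, k))"
        using that k A B by (simp add: scalar_prod_def lessThan_atLeast0)
      moreover have "(A * ?B) $$ (i, k) = (if i = k then char_poly M else 0)"
        unfolding adj_mat(2)[OF A] using that k by (simp add: A_def char_poly_def)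
      ultimately show ?thesis by (simp add: mult.commute)
    qed
    have "0 = (\<Sum>j<?n. (?B $$ (j, k)) \<star> (\<Sum>i<?n. (A $$ (i, j)) \<star> bs ! i))"
      by (simp add: col)
    also have "\<dots> = (\<Sum>j<?n. \<Sum>i<?n. (?B $$ (j, k) * A $$ (i, j)) \<star> bs ! i)"
      by (simp add: poly_module.scale_sum_right)
    also have "\<dots> = (\<Sum>i<?n. \<Sum>j<?n. (?B $$ (j, k) * A $$ (i, j)) \<star> bs ! i)"
      by (rule sum.swap)
    also have "\<dots> = (\<Sum>i<?n. (if i = k then char_poly M else 0) \<star> bs ! i)"
      unfolding poly_module.scale_sum_left[symmetric] by (intro sum.cong) (simp_all add: AB)
    also have "\<dots> = char_poly M \<star> bs ! k"
      using k by (simp add: if_distrib[of "\<lambda>f. f \<star> _"] cong: if_cong)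
    finally show ?thesis by simp
  qed
  have "subspace {x. char_poly M \<star> x = 0}"
    by (intro subspaceI) (auto simp: act_add act_scale)
  moreover have "set bs \<subseteq> {x. char_poly M \<star> x = 0}"
    using kill by (auto simp: in_set_conv_nth)
  ultimately have "span (set bs) \<subseteq> {x. char_poly M \<star> x = 0}" by (rule span_minimal[rotated])
  then show ?thesis using basis by (auto simp: is_basis_def)
qed

text \<open>
  A left eigenvector of the matrix is a semilinear functional \<open>\<phi>\<close> with \<open>\<phi> (u x) = c * \<phi> x\<close>.
\<close>
lemma ac_eigenvalue_root:
  assumes f: "\<And>x. f \<star> x = 0" and c: "ac_eigenvalue s u c"
  shows "c \<in> Root f"
proof -
  obtain bs M where rep: "represents s u bs M" and ev: "eigenvalue (map_mat to_ac M) c"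
    using c by (auto simp: ac_eigenvalue_def)
  let ?n = "length bs" and ?N = "map_mat to_ac M"
  have M: "M \<in> carrier_mat ?n ?n" and u: "\<And>j. j < ?n \<Longrightarrow> u (bs ! j) = (\<Sum>i<?n. s (M $$ (i, j)) (bs ! i))"
    and basis: "is_basis s bs" using rep by (auto simp: represents_def)
  have N: "?N \<in> carrier_mat ?n ?n" "transpose_mat ?N \<in> carrier_mat ?n ?n" using M by auto
  have "eigenvalue (transpose_mat ?N) c"
    using ev unfolding eigenvalue_root_char_poly[OF N(1)] eigenvalue_root_char_poly[OF N(2)]
    by (simp add: char_poly_transpose_mat[OF N(1)])
  then obtain y where y: "y \<in> carrier_vec ?n" "y \<noteq> 0\<^sub>v ?n" "transpose_mat ?N *\<^sub>v y = c \<cdot>\<^sub>v y"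
    using N unfolding eigenvalue_def eigenvector_def by auto
  have yj: "(\<Sum>i<?n. to_ac (M $$ (i, j)) * y $ i) = c * y $ j" if j: "j < ?n" for j
  proof -
    have "(transpose_mat ?N *\<^sub>v y) $ j = (\<Sum>i<?n. to_ac (M $$ (i, j)) * y $ i)"
      using j M y(1) by (simp add: scalar_prod_def lessThan_atLeast0)
    then show ?thesis unfolding y(3) using j y(1) by simp
  qed
  have B: "independent (set bs)" "span (set bs) = UNIV" "distinct bs"
    using basis by (auto simp: is_basis_def)
  define \<phi> where "\<phi> = (\<lambda>x. \<Sum>i<?n. to_ac (representation (set bs) x (bs ! i)) * y $ i)"
  have \<phi>_add: "\<phi> (x + z) = \<phi> x + \<phi> z" and \<phi>_scale: "\<phi> (s a x) = to_ac a * \<phi> x" for x z a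
    using B by (simp_all add: \<phi>_def representation_add representation_scale sum.distrib
        sum_distrib_left algebra_simps)
  have \<phi>_0: "\<phi> 0 = 0" using \<phi>_scale[of 0 0] by simp
  have \<phi>_sum: "\<phi> (sum g A) = (\<Sum>i\<in>A. \<phi> (g i))" for g and A :: "nat set"
    by (induction A rule: infinite_finite_induct) (simp_all add: \<phi>_0 \<phi>_add)
  have \<phi>_basis: "\<phi> (bs ! j) = y $ j" if j: "j < ?n" for j
  proof -
    have "\<phi> (bs ! j) = (\<Sum>i<?n. if i = j then y $ i else 0)"
      unfolding \<phi>_def using B j
      by (intro sum.cong) (auto simp: representation_basis nth_eq_iff_index_eq)
    then show ?thesis using j by simp
  qed
  have \<phi>_u: "\<phi> (u x) = c * \<phi> x" for x
  proof -
    have "subspace {x. \<phi> (u x) = c * \<phi> x}"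
      by (intro subspaceI) (auto simp: \<phi>_0 \<phi>_add \<phi>_scale algebra_simps)
    moreover have "set bs \<subseteq> {x. \<phi> (u x) = c * \<phi> x}"
      by (auto simp: in_set_conv_nth u \<phi>_sum \<phi>_scale \<phi>_basis yj)
    ultimately have "span (set bs) \<subseteq> {x. \<phi> (u x) = c * \<phi> x}" by (rule span_minimal[rotated])
    then show ?thesis using B(2) by auto
  qed
  have \<phi>_act: "\<phi> (g \<star> x) = poly (map_poly to_ac g) c * \<phi> x" for g x
    by (induction g) (simp_all add: act_0_poly act_pCons map_poly_pCons \<phi>_0 \<phi>_add \<phi>_scale \<phi>_u algebra_simps)
  obtain k where "k < ?n" "y $ k \<noteq> 0" using y(1,2) by (metis carrier_vecD eq_vecI index_zero_vec)
  then have "poly (map_poly to_ac f) c = 0"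
    using \<phi>_act[of f "bs ! k"] by (simp add: f \<phi>_0 \<phi>_basis)
  then show ?thesis by (simp add: Root_def)
qed

end

context quadratic_quotient begin

text \<open>The roots of the characteristic polynomial are eigenvalues, so it divides a power of the
  irreducible \<open>G\<close>, and Cayley-Hamilton applies. Conversely, eigenvalues are roots of
  every annihilating polynomial.\<close>

lemma exceptional_iff: "q_exceptional s p q u \<longleftrightarrow> (\<exists>n. \<forall>x. (G ^ n) \<star> x = 0)"
proof
  assume exc: "q_exceptional s p q u"
  obtain bs M where rep: "represents s u bs M" using represents_exists by blast
  then have M: "M \<in> carrier_mat (length bs) (length bs)" by (simp add: represents_def)
  interpret ac: comm_ring_hom "to_ac :: 'a \<Rightarrow> _" by unfold_locales simp_all
  have "Root (char_poly M) \<subseteq> Root G"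
  proof
    fix c assume "c \<in> Root (char_poly M)"
    then have "eigenvalue (map_mat to_ac M) c"
      using M by (simp add: eigenvalue_root_char_poly ac.char_poly_hom[OF M] Root_def)
    then have "ac_eigenvalue s u c" using rep by (auto simp: ac_eigenvalue_def)
    then show "c \<in> Root G"
      using exc by (simp add: q_exceptional_def Root_quot_poly[OF p q \<beta>_nz])
  qed
  moreover have "char_poly M \<noteq> 0" using degree_monic_char_poly[OF M] by auto
  ultimately obtain n h where "G ^ n = char_poly M * h"
    using dvd_power_if_Root_subset[OF irreducible_G] unfolding dvd_def by blast
  then have "(G ^ n) \<star> x = 0" for x
    by (simp add: act_mult char_poly_act[OF rep] del: poly_module.scale_scale)
  then show "\<exists>n. \<forall>x. (G ^ n) \<star> x = 0" by blast
next
  assume "\<exists>n. \<forall>x. (G ^ n) \<star> x = 0"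
  then obtain n where "\<And>x. (G ^ n) \<star> x = 0" by blast
  then have "ac_eigenvalue s u c \<Longrightarrow> c \<in> Root G" for c
    using ac_eigenvalue_root Root_power by blast
  then show "q_exceptional s p q u"
    by (simp add: q_exceptional_def Root_quot_poly[OF p q \<beta>_nz])
qed

end

section \<open>Invariant factors\<close>

text \<open>
  If two paired entries differed by more than \<open>1\<close>, then for some \<open>j\<close> an odd number of exponents
  would be at least \<open>j\<close>, so some pair would be \<open>(j, j - 1)\<close>; but no exponent would equal \<open>j - 1\<close>.
\<close>
lemma sorted_pairs:
  fixes es :: "nat list" and ns :: "(nat \<times> nat) list"
  assumes desc: "\<And>i j. i \<le> j \<Longrightarrow> j < length es \<Longrightarrow> es ! j \<le> es ! i"
    and ns: "\<forall>(n, n')\<in>set ns. n' = n \<or> n' = n - 1"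
    and mset: "mset es = mset (concat (map (\<lambda>(n, n'). [n, n']) ns))"
    and k: "Suc (2 * k) < length es"
  shows "es ! (2 * k) \<le> Suc (es ! Suc (2 * k))"
proof (rule ccontr)
  define L where "L = concat (map (\<lambda>(n, n'). [n, n']) ns)"
  define c where "c = (\<lambda>j. length (filter (\<lambda>x. j \<le> x) L))"
  assume "\<not> es ! (2 * k) \<le> Suc (es ! Suc (2 * k))"
  then have gap: "Suc (es ! Suc (2 * k)) < es ! (2 * k)" by simp
  define j where "j = es ! (2 * k)"
  \<comment> \<open>By monotonicity and the gap, the exponents that are at least \<open>i\<close>
    sit exactly at the indices \<open>0\<close> to \<open>2 * k\<close>.\<close>
  have c: "c i = Suc (2 * k)" if i: "es ! Suc (2 * k) < i" "i \<le> j" for i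
  proof -
    have "c i = length (filter (\<lambda>x. i \<le> x) es)"
      unfolding c_def using mset by (metis L_def mset_filter size_mset)
    also have "\<dots> = card {l. l < length es \<and> i \<le> es ! l}" by (rule length_filter_conv_card)
    also have "{l. l < length es \<and> i \<le> es ! l} = {..2 * k}"
    proof (intro Set.set_eqI iffI)
      fix l assume "l \<in> {l. l < length es \<and> i \<le> es ! l}"
      then have l: "l < length es" "i \<le> es ! l" by auto
      show "l \<in> {..2 * k}"
      proof (rule ccontr)
        assume "l \<notin> {..2 * k}"
        then have "es ! l \<le> es ! Suc (2 * k)" using l by (intro desc) auto
        then show False using l i by simp
      qed
    next
      fix l assume "l \<in> {..2 * k}"
      then show "l \<in> {l. l < length es \<and> i \<le> es ! l}"
        using k i desc[of l "2 * k"] by (auto simp: j_def)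
    qed
    finally show ?thesis by simp
  qed
  have cj: "c j = Suc (2 * k)" "c (j - 1) = Suc (2 * k)" "j \<ge> 2" using gap by (auto intro!: c simp: j_def)
  have mono: "length (filter (\<lambda>x. j \<le> x) xs) \<le> length (filter (\<lambda>x. j - 1 \<le> x) xs)" for xs
    by (induction xs) auto
  \<comment> \<open>An odd contribution to \<open>c j\<close> comes only from a pair
    \<open>(j, j - 1)\<close>, and this pair contributes one more to
    \<open>c (j - 1)\<close>.\<close>
  have "even (length (filter (\<lambda>x. j \<le> x) (concat (map (\<lambda>(n, n'). [n, n']) ns)))) \<or>
    length (filter (\<lambda>x. j \<le> x) (concat (map (\<lambda>(n, n'). [n, n']) ns)))
      < length (filter (\<lambda>x. j - 1 \<le> x) (concat (map (\<lambda>(n, n'). [n, n']) ns)))"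
    using ns
  proof (induction ns)
    case (Cons a ns)
    obtain n n' where a: "a = (n, n')" by (cases a)
    show ?case
      using Cons mono[of "concat (map (\<lambda>(n, n'). [n, n']) ns)"] \<open>j \<ge> 2\<close> by (auto simp: a)
  qed simp
  then show False using cj unfolding c_def L_def by simp
qed

context fd_endomorphism begin

lemma is_basis_cyclic_list_cong:
  assumes "mset xs = mset ys" shows "is_basis s (cyclic_list xs) \<longleftrightarrow> is_basis s (cyclic_list ys)"
proof -
  have "mset (cyclic_list xs) = mset (cyclic_list ys)"
    unfolding cyclic_list_def mset_concat sum_mset_sum_list[symmetric] mset_map assms by simp
  then show ?thesis
    unfolding is_basis_def by (metis mset_eq_imp_distinct_iff mset_eq_setD)
qed

lemma annihilated_cong: "mset xs = mset ys \<Longrightarrow> annihilated xs \<longleftrightarrow> annihilated ys"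
  using mset_eq_setD[of xs ys] by (simp add: annihilated_def)

end

section \<open>Comparison of the three conditions through generators\<close>

context quadratic_quotient begin

text \<open>Condition (iii) in terms of generators and exponents instead of matrices. It is the
  pivot to which all three conditions are related.\<close>

definition decomposable :: bool where
  "decomposable \<longleftrightarrow> (\<exists>ps. (\<forall>(v, n, v', n')\<in>set ps. 1 \<le> n \<and> (n' = n \<or> n' = n - 1)) \<and>
     annihilated (pair_list G ps) \<and> is_basis s (cyclic_list (pair_list G ps)))"

lemma monic_power_G: "lead_coeff (G ^ k) = 1"
  unfolding lead_coeff_power monic_G by simp

lemma degree_power_G: "degree (G ^ k) = 4 * k"
  using degree_power_eq[of G k] degree_G by (metis degree_0 mult.commute zero_neq_numeral)

lemma power_G_eq_iff: "G ^ k = G ^ l \<longleftrightarrow> k = l"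
  by (metis degree_power_G mult_cancel1 zero_neq_numeral)

lemma power_G_act_if_decomposition:
  assumes "annihilated (pair_list G ps)" "is_basis s (cyclic_list (pair_list G ps))"
  shows "\<exists>N. \<forall>x. (G ^ N) \<star> x = 0"
proof -
  have "\<exists>N. \<forall>(v, r)\<in>set (pair_list G ps). r dvd G ^ N"
  proof (induction ps)
    case (Cons a ps)
    obtain v n v' n' where a: "a = (v, n, v', n')" by (cases a)
    obtain N where N: "\<forall>(v, r)\<in>set (pair_list G ps). r dvd G ^ N" using Cons by blast
    have "\<forall>(v, r)\<in>set (pair_list G (a # ps)). r dvd G ^ (N + n + n')"
    proof -
      have "pair_list G (a # ps) = (v, G ^ n) # (v', G ^ n') # pair_list G ps"
        by (simp add: pair_list_def a)
      moreover have "G ^ k dvd G ^ (N + n + n')" if "k \<in> {N, n, n'}" for k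
        using that by (intro le_imp_power_dvd) auto
      ultimately show ?thesis using N by (auto intro: dvd_trans)
    qed
    then show ?case by blast
  qed (simp add: pair_list_def)
  then obtain N where "\<forall>(v, r)\<in>set (pair_list G ps). r dvd G ^ N" by blast
  then have "(G ^ N) \<star> x = 0" for x
    using assms by (intro cyclic_list_annihilator) (auto simp: is_basis_def)
  then show ?thesis by blast
qed

lemma exceptional_quotient_iff_decomposable:
  "is_quotient s p q u \<and> q_exceptional s p q u \<longleftrightarrow> decomposable"
proof
  assume "is_quotient s p q u \<and> q_exceptional s p q u"
  then obtain C N where C: "twist C" and N: "\<And>x. (G ^ N) \<star> x = 0"
    using twist_if_quotient(2) exceptional_iff by blast
  show decomposable
    using decomposition_if_twist[OF N C] is_basisI unfolding decomposable_def by blast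
next
  assume decomposable
  then obtain ps where ps: "\<forall>(v, n, v', n')\<in>set ps. 1 \<le> n \<and> (n' = n \<or> n' = n - 1)"
    "annihilated (pair_list G ps)" "is_basis s (cyclic_list (pair_list G ps))"
    unfolding decomposable_def by blast
  obtain N where N: "\<And>x. (G ^ N) \<star> x = 0" using power_G_act_if_decomposition[OF ps(2,3)] by blast
  obtain C where "twist C" using twist_if_decomposition[OF bij_u ps] N by blast
  then show "is_quotient s p q u \<and> q_exceptional s p q u"
    using quotient_if_twist[OF N] exceptional_iff N by blast
qed

text \<open>Flattening the double blocks gives a list of companion matrices to which
  \<open>represents_diag_companion\<close> applies; the resulting generators are then regrouped in
  pairs.\<close>

lemma represents_pairs_iff:
  "(\<exists>bs. represents s u bs (diag_block_mat
      (map (\<lambda>(n, n'). diag_block_mat [companion (G ^ n), companion (G ^ n')]) ns))) \<longleftrightarrow>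
   (\<exists>ps. map (\<lambda>(v, n, v', n'). (n, n')) ps = ns \<and> annihilated (pair_list G ps) \<and>
      is_basis s (cyclic_list (pair_list G ps)))"
proof -
  define rs where "rs = concat (map (\<lambda>(n, n'). [G ^ n, G ^ n']) ns)"
  have "map (\<lambda>(n, n'). diag_block_mat [companion (G ^ n), companion (G ^ n')]) ns =
      map diag_block_mat (map (\<lambda>(n, n'). [companion (G ^ n), companion (G ^ n')]) ns)"
    by (simp add: comp_def case_prod_unfold del: diag_block_mat.simps)
  moreover have "concat (map (\<lambda>(n, n'). [companion (G ^ n), companion (G ^ n')]) ns) = map companion rs"
    unfolding rs_def by (induction ns) auto
  ultimately have "diag_block_mat (map (\<lambda>(n, n'). diag_block_mat [companion (G ^ n), companion (G ^ n')]) ns)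
      = diag_block_mat (map companion rs)"
    by (simp only: diag_block_mat_concat)
  moreover have "\<forall>r\<in>set rs. lead_coeff r = 1" by (auto simp: rs_def monic_power_G)
  ultimately have *: "(\<exists>bs. represents s u bs (diag_block_mat
      (map (\<lambda>(n, n'). diag_block_mat [companion (G ^ n), companion (G ^ n')]) ns))) \<longleftrightarrow>
    (\<exists>xs. map snd xs = rs \<and> annihilated xs \<and> is_basis s (cyclic_list xs))"
    by (simp only: represents_diag_companion)
  have **: "map snd xs = rs \<longleftrightarrow>
      (\<exists>ps. map (\<lambda>(v, n, v', n'). (n, n')) ps = ns \<and> xs = pair_list G ps)" for xs :: "('v \<times> 'a poly) list"
    unfolding rs_def
  proof (induction ns arbitrary: xs)
    case Nil
    show ?case by (simp add: pair_list_def)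
  next
    case (Cons a ns)
    obtain n n' where a: "a = (n, n')" by (cases a)
    have "map snd xs = concat (map (\<lambda>(n, n'). [G ^ n, G ^ n']) (a # ns)) \<longleftrightarrow>
        (\<exists>v v' ys. xs = (v, G ^ n) # (v', G ^ n') # ys \<and>
          map snd ys = concat (map (\<lambda>(n, n'). [G ^ n, G ^ n']) ns))"
      by (auto simp: a map_eq_Cons_conv)
    also have "\<dots> \<longleftrightarrow> (\<exists>v v' ps. map (\<lambda>(v, n, v', n'). (n, n')) ps = ns \<and>
        xs = (v, G ^ n) # (v', G ^ n') # pair_list G ps)"
      unfolding Cons.IH by blast
    also have "\<dots> \<longleftrightarrow> (\<exists>ps. map (\<lambda>(v, n, v', n'). (n, n')) ps = a # ns \<and> xs = pair_list G ps)"
    proof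
      assume "\<exists>v v' ps. map (\<lambda>(v, n, v', n'). (n, n')) ps = ns \<and>
        xs = (v, G ^ n) # (v', G ^ n') # pair_list G ps"
      then obtain v v' ps where "map (\<lambda>(v, n, v', n'). (n, n')) ps = ns"
        "xs = (v, G ^ n) # (v', G ^ n') # pair_list G ps" by blast
      then show "\<exists>ps. map (\<lambda>(v, n, v', n'). (n, n')) ps = a # ns \<and> xs = pair_list G ps"
        by (intro exI[of _ "(v, n, v', n') # ps"]) (simp add: a pair_list_def)
    next
      assume "\<exists>ps. map (\<lambda>(v, n, v', n'). (n, n')) ps = a # ns \<and> xs = pair_list G ps"
      then obtain x ps where "(\<lambda>(v, n, v', n'). (n, n')) x = a" "map (\<lambda>(v, n, v', n'). (n, n')) ps = ns"
        "xs = pair_list G (x # ps)" by (auto simp: map_eq_Cons_conv)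
      then show "\<exists>v v' ps. map (\<lambda>(v, n, v', n'). (n, n')) ps = ns \<and>
        xs = (v, G ^ n) # (v', G ^ n') # pair_list G ps"
        by (cases x) (auto simp: a pair_list_def)
    qed
    finally show ?case .
  qed
  show ?thesis unfolding * ** by blast
qed

lemma block_diagonal_iff_decomposable:
  "(\<exists>bs Bs. represents s u bs (diag_block_mat Bs) \<and>
      (\<forall>B\<in>set Bs. \<exists>n\<ge>1.
         B = diag_block_mat [companion (G ^ n), companion (G ^ n)] \<or>
         B = diag_block_mat [companion (G ^ n), companion (G ^ (n - 1))])) \<longleftrightarrow> decomposable"
proof
  assume "\<exists>bs Bs. represents s u bs (diag_block_mat Bs) \<and>
      (\<forall>B\<in>set Bs. \<exists>n\<ge>1.
         B = diag_block_mat [companion (G ^ n), companion (G ^ n)] \<or>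
         B = diag_block_mat [companion (G ^ n), companion (G ^ (n - 1))])"
  then obtain bs Bs where rep: "represents s u bs (diag_block_mat Bs)"
    and Bs: "\<And>B. B \<in> set Bs \<Longrightarrow> \<exists>n n'. (1 \<le> n \<and> (n' = n \<or> n' = n - 1)) \<and>
         B = diag_block_mat [companion (G ^ n), companion (G ^ n')]"
    by blast
  have "\<exists>ns. (\<forall>(n, n')\<in>set ns. 1 \<le> n \<and> (n' = n \<or> n' = n - 1)) \<and>
      Bs = map (\<lambda>(n, n'). diag_block_mat [companion (G ^ n), companion (G ^ n')]) ns"
    using Bs
  proof (induction Bs)
    case (Cons B Bs)
    obtain n n' where B: "1 \<le> n \<and> (n' = n \<or> n' = n - 1)"
      "B = diag_block_mat [companion (G ^ n), companion (G ^ n')]"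
      using Cons.prems[of B] by auto
    obtain ns where "\<forall>(n, n')\<in>set ns. 1 \<le> n \<and> (n' = n \<or> n' = n - 1)"
      "Bs = map (\<lambda>(n, n'). diag_block_mat [companion (G ^ n), companion (G ^ n')]) ns"
      using Cons.IH[OF Cons.prems[OF list.set_intros(2)]] by blast
    then show ?case using B by (intro exI[of _ "(n, n') # ns"]) (simp del: diag_block_mat.simps)
  qed simp
  then obtain ns where ns: "\<forall>(n, n')\<in>set ns. 1 \<le> n \<and> (n' = n \<or> n' = n - 1)"
    "Bs = map (\<lambda>(n, n'). diag_block_mat [companion (G ^ n), companion (G ^ n')]) ns" by blast
  then obtain ps where ps: "map (\<lambda>(v, n, v', n'). (n, n')) ps = ns" "annihilated (pair_list G ps)"
      "is_basis s (cyclic_list (pair_list G ps))"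
    using represents_pairs_iff[of ns] rep by blast
  have "\<forall>(v, n, v', n')\<in>set ps. 1 \<le> n \<and> (n' = n \<or> n' = n - 1)"
    using ns(1) unfolding ps(1)[symmetric] by auto
  then show decomposable unfolding decomposable_def using ps by blast
next
  assume decomposable
  then obtain ps where ps: "\<forall>(v, n, v', n')\<in>set ps. 1 \<le> n \<and> (n' = n \<or> n' = n - 1)"
    "annihilated (pair_list G ps)" "is_basis s (cyclic_list (pair_list G ps))"
    unfolding decomposable_def by blast
  define ns where "ns = map (\<lambda>(v, n, v', n'). (n, n')) ps"
  define Bs where "Bs = map (\<lambda>(n, n'). diag_block_mat [companion (G ^ n), companion (G ^ n')]) ns"
  have "\<exists>bs. represents s u bs (diag_block_mat Bs)"
    unfolding Bs_def represents_pairs_iff using ps(2,3) ns_def by blast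
  moreover have "\<exists>n\<ge>1. B = diag_block_mat [companion (G ^ n), companion (G ^ n)] \<or>
         B = diag_block_mat [companion (G ^ n), companion (G ^ (n - 1))]" if B_in: "B \<in> set Bs" for B
  proof -
    obtain x where x: "x \<in> set ps" "B = (\<lambda>(n, n'). diag_block_mat [companion (G ^ n), companion (G ^ n')])
        ((\<lambda>(v, n, v', n'). (n, n')) x)"
      using B_in unfolding Bs_def ns_def set_map by blast
    obtain v n v' n' where [simp]: "x = (v, n, v', n')" by (cases x)
    have B: "B = diag_block_mat [companion (G ^ n), companion (G ^ n')]"
      using x(2) by (simp del: diag_block_mat.simps)
    have "1 \<le> n" "n' = n \<or> n' = n - 1" using ps(1) x(1) by auto
    then show ?thesis using B by blast
  qed
  ultimately show "\<exists>bs Bs. represents s u bs (diag_block_mat Bs) \<and>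
      (\<forall>B\<in>set Bs. \<exists>n\<ge>1.
         B = diag_block_mat [companion (G ^ n), companion (G ^ n)] \<or>
         B = diag_block_mat [companion (G ^ n), companion (G ^ (n - 1))])" by blast
qed

text \<open>If \<open>f = G ^ j * h\<close> annihilates the space and \<open>G\<close> does not
  divide \<open>h\<close>, then \<open>h\<close> acts invertibly and \<open>G ^ j\<close> already
  annihilates it, so \<open>j\<close> is at least the least exponent \<open>n\<close>.\<close>

lemma minimal_polynomial_power_G:
  assumes "\<And>x. (G ^ N) \<star> x = 0"
  shows "\<exists>n. is_minimal_polynomial s u (G ^ n)"
proof -
  define n where "n = (LEAST n. \<forall>x. (G ^ n) \<star> x = 0)"
  have n: "(G ^ n) \<star> x = 0" for x
    using LeastI[of "\<lambda>n. \<forall>x. (G ^ n) \<star> x = 0" N] assms unfolding n_def by blast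
  have "G ^ n dvd f" if f: "\<And>x. f \<star> x = 0" for f
  proof -
    have "G ^ j dvd f" if "j \<le> n" for j
      using that
    proof (induction j)
      case (Suc j)
      then obtain h where h: "f = G ^ j * h" by (auto simp: dvd_def)
      have "G dvd h"
      proof (rule ccontr)
        assume "\<not> G dvd h"
        then obtain e where e: "\<And>x. (G ^ n) \<star> x = 0 \<Longrightarrow> e \<star> h \<star> x = x"
          using act_inverse[OF irreducible_G] by blast
        have "(G ^ j) \<star> x = 0" for x
        proof -
          have "h \<star> (G ^ j) \<star> x = f \<star> x" unfolding h by (simp add: mult.commute)
          then have "h \<star> (G ^ j) \<star> x = 0" by (simp only: f)
          then show ?thesis using e[OF n, of "(G ^ j) \<star> x"] by (simp del: poly_module.scale_scale)
        qed
        then have "n \<le> j" unfolding n_def by (intro Least_le) blast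
        then show False using Suc.prems by simp
      qed
      then show ?case by (simp add: h mult.commute mult_dvd_mono)
    qed simp
    then show ?thesis by simp
  qed
  then show ?thesis
    unfolding is_minimal_polynomial_def using n monic_power_G by blast
qed

text \<open>The exponents of all pairs, in decreasing order, are those of the invariant factors.
  Sorting may tear pairs apart; \<open>sorted_pairs\<close> controls the new neighbours.\<close>

lemma invariant_factors_if_decomposable:
  assumes decomposable
  shows "(\<exists>n. is_minimal_polynomial s u (G ^ n)) \<and>
    (\<exists>r. is_invariant_factors s u r \<and> (\<forall>k. r (2 * k) = r (2 * k + 1) \<or> r (2 * k) = r (2 * k + 1) * G))"
proof -
  obtain ps where ps: "\<forall>(v, n, v', n')\<in>set ps. 1 \<le> n \<and> (n' = n \<or> n' = n - 1)"
    "annihilated (pair_list G ps)" "is_basis s (cyclic_list (pair_list G ps))"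
    using assms unfolding decomposable_def by blast
  define vs where "vs = concat (map (\<lambda>(v, n, v', n'). [(v, n), (v', n')]) ps)"
  define ws where "ws = rev (sort_key snd vs)"
  define es where "es = map snd ws"
  define xs where "xs = map (\<lambda>(v, n). (v, G ^ n)) ws"
  have "pair_list G ps = map (\<lambda>(v, n). (v, G ^ n)) vs"
    unfolding pair_list_def vs_def by (induction ps) auto
  then have "mset xs = mset (pair_list G ps)" by (simp add: xs_def ws_def)
  then have xs: "annihilated xs" "is_basis s (cyclic_list xs)"
    using ps(2,3) annihilated_cong is_basis_cyclic_list_cong by blast+
  have len: "length es = 2 * length ps"
    unfolding es_def ws_def vs_def by (induction ps) auto
  define r where "r = (\<lambda>i. if i < length es then G ^ (es ! i) else 1)"
  have "sorted (rev es)" by (simp add: es_def ws_def rev_map)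
  then have desc: "es ! j \<le> es ! i" if "i \<le> j" "j < length es" for i j
    using that by (simp add: sorted_rev_iff_nth_mono)
  have "map snd xs = map r [0..<length es]"
    by (rule nth_equalityI) (auto simp: xs_def es_def r_def case_prod_unfold)
  then have "\<exists>bs. represents s u bs (diag_block_mat (map (\<lambda>i. companion (r i)) [0..<length es]))"
    using represents_diag_companion[of "map r [0..<length es]"] xs monic_power_G
    by (auto simp: r_def comp_def)
  moreover have "lead_coeff (r i) = 1 \<and> r (Suc i) dvd r i" for i
    using monic_power_G desc[of i "Suc i"] by (auto simp: r_def intro: le_imp_power_dvd)
  moreover have "\<forall>i\<ge>length es. r i = 1" by (simp add: r_def)
  ultimately have "is_invariant_factors s u r" unfolding is_invariant_factors_def by blast
  moreover have "r (2 * k) = r (2 * k + 1) \<or> r (2 * k) = r (2 * k + 1) * G" for k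
  proof (cases "2 * k < length es")
    case True
    \<comment> \<open>The list has even length, so an entry at an even index always has its partner
      inside the list.\<close>
    then have k: "Suc (2 * k) < length es" using len by presburger
    have "mset es = mset (map snd vs)" by (simp add: es_def ws_def)
    also have "map snd vs = concat (map (\<lambda>(n, n'). [n, n']) (map (\<lambda>(v, n, v', n'). (n, n')) ps))"
      unfolding vs_def by (induction ps) auto
    finally have m: "mset es = mset (concat (map (\<lambda>(n, n'). [n, n']) (map (\<lambda>(v, n, v', n'). (n, n')) ps)))" .
    have "\<forall>(n, n')\<in>set (map (\<lambda>(v, n, v', n'). (n, n')) ps). n' = n \<or> n' = n - 1"
      using ps(1) by auto
    from sorted_pairs[OF desc this m k] have "es ! (2 * k) \<le> Suc (es ! Suc (2 * k))" by simp
    moreover have "es ! Suc (2 * k) \<le> es ! (2 * k)" using k by (intro desc) auto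
    ultimately consider "es ! (2 * k) = es ! Suc (2 * k)" | "es ! (2 * k) = Suc (es ! Suc (2 * k))"
      by linarith
    then show ?thesis using k by cases (simp_all add: r_def mult.commute)
  qed (simp add: r_def)
  moreover have "\<exists>n. is_minimal_polynomial s u (G ^ n)"
    using power_G_act_if_decomposition[OF ps(2,3)] minimal_polynomial_power_G by blast
  ultimately show ?thesis by blast
qed

lemma decomposable_if_invariant_factors:
  assumes min: "is_minimal_polynomial s u (G ^ m)" and inv: "is_invariant_factors s u r"
    and pairs: "\<And>k. r (2 * k) = r (2 * k + 1) \<or> r (2 * k) = r (2 * k + 1) * G"
  shows decomposable
proof -
  have monic: "lead_coeff (r i) = 1" for i using inv by (simp add: is_invariant_factors_def)
  obtain N where N: "\<forall>i\<ge>N. r i = 1"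
    and rep: "\<exists>bs. represents s u bs (diag_block_mat (map (\<lambda>i. companion (r i)) [0..<N]))"
    using inv unfolding is_invariant_factors_def by blast
  then obtain xs where xs: "map snd xs = map r [0..<N]" "annihilated xs" "is_basis s (cyclic_list xs)"
    using represents_diag_companion[of "map r [0..<N]"] monic by (auto simp: comp_def)
  \<comment> \<open>Padding with zero vectors of order \<open>1\<close> gives every index a partner,
    even for odd \<open>N\<close>, and contributes nothing to the basis.\<close>
  define ys where "ys = xs @ replicate N (0, 1)"
  have len_xs: "length xs = N" using xs(1) by (metis length_map length_upt minus_nat.diff_0)
  have snd_ys: "snd (ys ! i) = r i" if "i < 2 * N" for i
    using that N len_xs arg_cong[OF xs(1), of "\<lambda>xs. xs ! i"] by (auto simp: ys_def nth_append)
  have ann: "annihilated ys" using xs(2) by (auto simp: annihilated_def ys_def)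
  have "concat (map (\<lambda>(v, r). chain v (degree r)) (replicate n (0, 1))) = []" for n
    by (induction n) (auto simp: chain_def)
  then have "cyclic_list ys = cyclic_list xs"
    unfolding ys_def cyclic_list_def by simp
  then have basis: "is_basis s (cyclic_list ys)" using xs(3) by simp
  have kill: "(G ^ m) \<star> x = 0" for x using min by (simp add: is_minimal_polynomial_def)
  \<comment> \<open>As the order of a generator, \<open>r i\<close> divides every annihilating
    polynomial, in particular \<open>G ^ m\<close>, and monic divisors of that are powers of
    \<open>G\<close>.\<close>
  have "\<exists>e. r i = G ^ e" if "i < 2 * N" for i
  proof -
    have "(fst (ys ! i), r i) \<in> set ys"
      using that len_xs snd_ys[OF that] by (metis (no_types, lifting) length_append length_replicate mult_2 nth_mem prod.collapse ys_def)
    then have "r i dvd G ^ m" using basis ann kill by (intro cyclic_list_dvd) 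
    then show ?thesis using irreducible_poly_dvd_power[OF irreducible_G monic_G monic] by blast
  qed
  then obtain e where e: "r i = G ^ e i" if "i < 2 * N" for i by metis
  have "\<exists>ps. (\<forall>(v, n, v', n')\<in>set ps. 1 \<le> n \<and> (n' = n \<or> n' = n - 1)) \<and>
     annihilated (pair_list G ps) \<and> cyclic_list (pair_list G ps) = cyclic_list (take (2 * k) ys)"
    if "k \<le> N" for k
    using that
  proof (induction k)
    case 0
    show ?case by (intro exI[of _ "[]"]) (simp add: pair_list_def annihilated_def)
  next
    case (Suc k)
    then obtain ps where ps: "\<forall>(v, n, v', n')\<in>set ps. 1 \<le> n \<and> (n' = n \<or> n' = n - 1)"
      "annihilated (pair_list G ps)" "cyclic_list (pair_list G ps) = cyclic_list (take (2 * k) ys)" by auto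
    have k: "2 * k < 2 * N" "Suc (2 * k) < 2 * N" using Suc.prems by auto
    then have lt: "2 * k < length ys" "Suc (2 * k) < length ys" using len_xs by (simp_all add: ys_def)
    obtain v v' where v: "ys ! (2 * k) = (v, G ^ e (2 * k))" "ys ! Suc (2 * k) = (v', G ^ e (Suc (2 * k)))"
      using snd_ys k e by (metis prod.collapse)
    have take: "take (2 * Suc k) ys = take (2 * k) ys @ [(v, G ^ e (2 * k)), (v', G ^ e (Suc (2 * k)))]"
      using lt by (simp add: take_Suc_conv_app_nth v)
    have "e (2 * k) = e (Suc (2 * k)) \<or> e (2 * k) = Suc (e (Suc (2 * k)))"
    proof -
      have "G ^ e (2 * k) = G ^ e (Suc (2 * k)) \<or> G ^ e (2 * k) = G ^ Suc (e (Suc (2 * k)))"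
        using pairs[of k] e[OF k(1)] e[OF k(2)] by (simp add: mult.commute)
      then show ?thesis unfolding power_G_eq_iff .
    qed
    then consider "e (2 * k) = 0" "e (Suc (2 * k)) = 0"
      | "1 \<le> e (2 * k)" "e (Suc (2 * k)) = e (2 * k) \<or> e (Suc (2 * k)) = e (2 * k) - 1" by force
    then show ?case
    proof cases
      \<comment> \<open>A pair of trivial factors yields no basis vectors; it is dropped, since a
        tuple must have \<open>1 \<le> n\<close>.\<close>
      case 1
      then have "cyclic_list (take (2 * Suc k) ys) = cyclic_list (take (2 * k) ys)"
        unfolding take by (simp add: cyclic_list_def chain_def)
      then show ?thesis using ps by (intro exI[of _ ps]) simp
    next
      case 2
      define ps' where "ps' = ps @ [(v, e (2 * k), v', e (Suc (2 * k)))]"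
      have pl: "pair_list G ps' = pair_list G ps @ [(v, G ^ e (2 * k)), (v', G ^ e (Suc (2 * k)))]"
        by (simp add: ps'_def pair_list_def)
      have "ys ! (2 * k) \<in> set ys" "ys ! Suc (2 * k) \<in> set ys" using lt by auto
      then have "annihilated (pair_list G ps')"
        using ps(2) ann unfolding pl v by (auto simp: annihilated_def)
      moreover have "cyclic_list (pair_list G ps') = cyclic_list (take (2 * Suc k) ys)"
        unfolding take pl using ps(3) by (simp add: cyclic_list_def)
      moreover have "\<forall>(v, n, v', n')\<in>set ps'. 1 \<le> n \<and> (n' = n \<or> n' = n - 1)"
        using ps(1) 2 by (auto simp: ps'_def)
      ultimately show ?thesis by blast
    qed
  qed
  from this[of N] obtain ps where "\<forall>(v, n, v', n')\<in>set ps. 1 \<le> n \<and> (n' = n \<or> n' = n - 1)"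
    "annihilated (pair_list G ps)" "cyclic_list (pair_list G ps) = cyclic_list ys"
    using len_xs by (auto simp: ys_def)
  then show ?thesis unfolding decomposable_def using basis by (intro exI[of _ ps]) simp
qed

end

theorem theorem4p33:
  fixes p q :: "'a::field poly"
    and s :: "'a \<Rightarrow> 'v::ab_group_add \<Rightarrow> 'v"
    and Basis :: "'v set"
    and u :: "'v \<Rightarrow> 'v"
  assumes "lead_coeff p = 1" and "degree p = 2"
    and "lead_coeff q = 1" and "degree q = 2"
    and "Factorial_Ring.irreducible p" and "Factorial_Ring.irreducible q"
    and "separable_poly p" and "separable_poly q"
    and "splitting_field p \<noteq> splitting_field q"
    and "(poly_tr p, poly_tr q) \<noteq> (0, 0)"
    and "finite_dimensional_vector_space s Basis"
    and "Vector_Spaces.linear s s u"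
  shows
    "((is_quotient s p q u \<and> q_exceptional s p q u) \<longleftrightarrow>
       ((\<exists>n. is_minimal_polynomial s u (quot_poly p q ^ n)) \<and>
        (\<exists>r. is_invariant_factors s u r \<and>
             (\<forall>k. r (2 * k) = r (2 * k + 1) \<or> r (2 * k) = r (2 * k + 1) * quot_poly p q)))) \<and>
     ((is_quotient s p q u \<and> q_exceptional s p q u) \<longleftrightarrow>
       (\<exists>bs Bs. represents s u bs (diag_block_mat Bs) \<and>
          (\<forall>B\<in>set Bs. \<exists>n\<ge>1.
             B = diag_block_mat [companion (quot_poly p q ^ n), companion (quot_poly p q ^ n)] \<or>
             B = diag_block_mat [companion (quot_poly p q ^ n), companion (quot_poly p q ^ (n - 1))])))"
proof -
  interpret finite_dimensional_vector_space s Basis by fact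
  interpret quadratic_quotient s u Basis p q
    by (intro quadratic_quotient.intro fd_endomorphism.intro endomorphism.intro endomorphism_axioms.intro
        quadratic_quotient_axioms.intro assms vector_space_axioms finite_dimensional_vector_space_axioms)
  show ?thesis
    unfolding exceptional_quotient_iff_decomposable block_diagonal_iff_decomposable
    using invariant_factors_if_decomposable decomposable_if_invariant_factors by blast
qed

end
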